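(* Let $(M,\eta,\omega)$ be a conformal symplectic manifold, $H:M\to\mathbb{R}$ a Hamiltonian, $\mathcal{F}=\ker\mathrm{d}_\eta H$, and let $L$ be a submanifold of $M$. (1) If $L$ is isotropic and invariant, then it is tangent to $\mathcal{F}$. (2) If $L$ is coisotropic and tangent to $\mathcal{F}$, then it is invariant. (3) If $L$ is invariant and tangent to $\mathcal{F}$, then the pull-back of $\omega$ to $L$ is degenerate. In particular, if $L$ is of even dimension $2k$, the pull-back of $\omega^k$ to $L$ is zero. An invariant surface tangent to $\mathcal{F}$ is thus isotropic.
   Context: A conformal symplectic manifold $(M,\eta,\omega)$ is a smooth manifold $M$ of even dimension with a closed 1-form $\eta$ (the Lee form) and a non-degenerate 2-form $\omega$ such that $\mathrm{d}_\eta\omega=0$, where $\mathrm{d}_\eta\alpha:=\mathrm{d}\alpha-\eta\wedge\alpha$. Given a smooth $H:M\to\mathbb{R}$ (the Hamiltonian), its Hamiltonian vector field $X$ is defined by $\iota_X\omega=\mathrm{d}_\eta H=\mathrm{d}H-H\eta$. "Invariant" means invariant under the Hamiltonian flow of $H$, that is, the flow of $X$. A submanifold $L$ is isotropic if $TL\subset TL^\omega$ and coisotropic if $TL^\omega\subset TL$, where $TL^\omega$ is the $\omega$-orthogonal of $TL$. It is tangent to the (possibly singular) distribution $\mathcal{F}$ if $T_xL\subset\ker(\mathrm{d}_\eta H)_x$ for all $x\in L$.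
   Formalization: (2) fails for non-closed L: local invariance under the flow is concluded for every L, invariance when L is a closed subset. (3) fails where d_ηH vanishes (H=0, L=M): its conclusions are asserted at the points of L that are limits of points of L where d_ηH is nonzero. *)

theory Defs
  imports "HOL-Analysis.Analysis"
begin

section \<open>Smooth maps between Euclidean spaces\<close>

text \<open>Both notions are meant for open sets \<open>S\<close>.\<close>

primrec Ck_on :: "nat \<Rightarrow> 'a::euclidean_space set \<Rightarrow> ('a \<Rightarrow> 'b::real_normed_vector) \<Rightarrow> bool" where
  "Ck_on 0 S f \<longleftrightarrow> continuous_on S f"
| "Ck_on (Suc k) S f \<longleftrightarrow> (\<forall>x\<in>S. f differentiable (at x)) \<and>
     (\<forall>v. Ck_on k S (\<lambda>x. frechet_derivative f (at x) v))"

definition smooth_on :: "'a::euclidean_space set \<Rightarrow> ('a \<Rightarrow> 'b::real_normed_vector) \<Rightarrow> bool" where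
  "smooth_on S f \<longleftrightarrow> (\<forall>k. Ck_on k S f)"


section \<open>Smooth manifolds\<close>

text \<open>A chart is its domain together with its coordinate map, whose values outside the domain are
  irrelevant. The manifold is the whole type \<open>'m\<close>, and its dimension is \<open>DIM('e)\<close>.\<close>

type_synonym ('m, 'e) chart = "'m set \<times> ('m \<Rightarrow> 'e)"

abbreviation cdom :: "('m, 'e) chart \<Rightarrow> 'm set" where "cdom \<equiv> fst"
abbreviation cmap :: "('m, 'e) chart \<Rightarrow> 'm \<Rightarrow> 'e" where "cmap \<equiv> snd"

definition cinv :: "('m, 'e) chart \<Rightarrow> 'e \<Rightarrow> 'm" where
  "cinv c = inv_into (cdom c) (cmap c)"

definition is_chart :: "('m::topological_space, 'e::euclidean_space) chart \<Rightarrow> bool" where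
  "is_chart c \<longleftrightarrow> open (cdom c) \<and> open (cmap c ` cdom c) \<and>
     homeomorphism (cdom c) (cmap c ` cdom c) (cmap c) (cinv c)"

definition smooth_transition ::
  "('m::topological_space, 'e::euclidean_space) chart \<Rightarrow> ('m, 'e) chart \<Rightarrow> bool" where
  "smooth_transition c c' \<longleftrightarrow> smooth_on (cmap c ` (cdom c \<inter> cdom c')) (cmap c' \<circ> cinv c)"

definition smooth_atlas ::
  "('m::{t2_space, second_countable_topology}, 'e::euclidean_space) chart set \<Rightarrow> bool" where
  "smooth_atlas A \<longleftrightarrow> (\<Union>c\<in>A. cdom c) = UNIV \<and> (\<forall>c\<in>A. is_chart c) \<and>
     (\<forall>c\<in>A. \<forall>c'\<in>A. smooth_transition c c')"

definition maximal_atlas ::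
  "('m::{t2_space, second_countable_topology}, 'e::euclidean_space) chart set \<Rightarrow> ('m, 'e) chart set" where
  "maximal_atlas A = {c. is_chart c \<and> (\<forall>c'\<in>A. smooth_transition c c' \<and> smooth_transition c' c)}"

text \<open>The tangent space \<open>T\<^sub>xM\<close> is identified with \<open>'e\<close> through one chart around \<open>x\<close>, chosen once
  and for all for each \<open>x\<close>: the vector \<open>v\<close> of \<open>'e\<close> stands for the tangent vector with
  coordinates \<open>v\<close> in that chart. The choice varies arbitrarily with \<open>x\<close>, so smoothness is always
  expressed after passing to a fixed chart with \<open>tangent_transition\<close>.\<close>

definition chart_at :: "('m, 'e) chart set \<Rightarrow> 'm \<Rightarrow> ('m, 'e) chart" where
  "chart_at A x = (SOME c. c \<in> A \<and> x \<in> cdom c)"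

text \<open>From coordinates in the chart \<open>c\<close> at \<open>x\<close> to coordinates in the chosen chart at \<open>x\<close>.\<close>

definition tangent_transition ::
  "('m, 'e::euclidean_space) chart set \<Rightarrow> ('m, 'e) chart \<Rightarrow> 'm \<Rightarrow> 'e \<Rightarrow> 'e" where
  "tangent_transition A c x =
     frechet_derivative (cmap (chart_at A x) \<circ> cinv c) (at (cmap c x))"

definition smooth_function ::
  "('m, 'e::euclidean_space) chart set \<Rightarrow> ('m \<Rightarrow> real) \<Rightarrow> bool" where
  "smooth_function A f \<longleftrightarrow> (\<forall>c\<in>A. smooth_on (cmap c ` cdom c) (f \<circ> cinv c))"


section \<open>Differential forms\<close>

text \<open>A \<open>p\<close>-linear form on \<open>'e\<close> is a function on lists; only its values on lists of length \<open>p\<close>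
  are relevant.\<close>

type_synonym 'e mform = "'e list \<Rightarrow> real"

definition alternating_form :: "nat \<Rightarrow> 'e::real_vector mform \<Rightarrow> bool" where
  "alternating_form p \<alpha> \<longleftrightarrow>
     (\<forall>vs. length vs = p \<longrightarrow> (\<forall>i<p. linear (\<lambda>u. \<alpha> (vs[i := u])))) \<and>
     (\<forall>vs. length vs = p \<longrightarrow> (\<forall>i<p. \<forall>j<p. i \<noteq> j \<and> vs ! i = vs ! j \<longrightarrow> \<alpha> vs = 0))"

definition wedge :: "nat \<Rightarrow> nat \<Rightarrow> 'e mform \<Rightarrow> 'e mform \<Rightarrow> 'e mform" where
  "wedge p q \<alpha> \<beta> vs = (1 / (fact p * fact q)) *
     (\<Sum>\<sigma> | \<sigma> permutes {..<p + q}. of_int (sign \<sigma>) *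
        \<alpha> (take p (permute_list \<sigma> vs)) * \<beta> (drop p (permute_list \<sigma> vs)))"

primrec wedge_power :: "'e mform \<Rightarrow> nat \<Rightarrow> 'e mform" where
  "wedge_power \<omega> 0 = (\<lambda>vs. 1)"
| "wedge_power \<omega> (Suc k) = wedge 2 (2 * k) \<omega> (wedge_power \<omega> k)"

type_synonym ('m, 'e) dform = "'m \<Rightarrow> 'e mform"

text \<open>The coordinate expression of a form in the chart \<open>c\<close>, i.e. its pull-back by \<open>cinv c\<close>.\<close>

definition local_form ::
  "('m, 'e::euclidean_space) chart set \<Rightarrow> ('m, 'e) chart \<Rightarrow> ('m, 'e) dform \<Rightarrow> 'e \<Rightarrow> 'e mform" where
  "local_form A c \<alpha> y vs = \<alpha> (cinv c y) (map (tangent_transition A c (cinv c y)) vs)"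

definition differential_form ::
  "('m, 'e::euclidean_space) chart set \<Rightarrow> nat \<Rightarrow> ('m, 'e) dform \<Rightarrow> bool" where
  "differential_form A p \<alpha> \<longleftrightarrow> (\<forall>x. alternating_form p (\<alpha> x)) \<and>
     (\<forall>c\<in>A. \<forall>vs. length vs = p \<longrightarrow> smooth_on (cmap c ` cdom c) (\<lambda>y. local_form A c \<alpha> y vs))"

text \<open>The exterior derivative is computed in the chosen chart at \<open>x\<close>, the very chart that
  identifies \<open>T\<^sub>xM\<close> with \<open>'e\<close>.\<close>

definition ext_deriv ::
  "('m, 'e::euclidean_space) chart set \<Rightarrow> nat \<Rightarrow> ('m, 'e) dform \<Rightarrow> ('m, 'e) dform" where
  "ext_deriv A p \<alpha> x vs = (\<Sum>i\<le>p. (-1) ^ i *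
     frechet_derivative (\<lambda>y. local_form A (chart_at A x) \<alpha> y (take i vs @ drop (Suc i) vs))
       (at (cmap (chart_at A x) x)) (vs ! i))"

definition lee_deriv ::
  "('m, 'e::euclidean_space) chart set \<Rightarrow> ('m, 'e) dform \<Rightarrow> nat \<Rightarrow> ('m, 'e) dform \<Rightarrow> ('m, 'e) dform" where
  "lee_deriv A \<eta> p \<alpha> x vs = ext_deriv A p \<alpha> x vs - wedge 1 p (\<eta> x) (\<alpha> x) vs"

text \<open>A function as a 0-form.\<close>

definition form0 :: "('m \<Rightarrow> real) \<Rightarrow> ('m, 'e) dform" where
  "form0 H x vs = H x"

lemma lee_deriv_form0:
  "lee_deriv A \<eta> 0 (form0 H) x [v] =
     frechet_derivative (H \<circ> cinv (chart_at A x)) (at (cmap (chart_at A x) x)) v - H x * \<eta> x [v]"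
proof -
  have "{\<sigma>. \<sigma> permutes {..<Suc 0}} = {id}"
    by (simp add: lessThan_Suc)
  then show ?thesis
    by (simp add: lee_deriv_def ext_deriv_def wedge_def form0_def local_form_def comp_def
        permute_list_def sign_id)
qed


section \<open>Conformal symplectic manifolds and Hamiltonian flows\<close>

definition conformal_symplectic ::
  "('m::{t2_space, second_countable_topology}, 'e::euclidean_space) chart set
     \<Rightarrow> ('m, 'e) dform \<Rightarrow> ('m, 'e) dform \<Rightarrow> bool" where
  "conformal_symplectic A \<eta> \<omega> \<longleftrightarrow>
     smooth_atlas A \<and> even DIM('e) \<and>
     differential_form A 1 \<eta> \<and> (\<forall>x vs. length vs = 2 \<longrightarrow> ext_deriv A 1 \<eta> x vs = 0) \<and>
     differential_form A 2 \<omega> \<and> (\<forall>x u. (\<forall>v. \<omega> x [u, v] = 0) \<longrightarrow> u = 0) \<and>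
     (\<forall>x vs. length vs = 3 \<longrightarrow> lee_deriv A \<eta> 2 \<omega> x vs = 0)"

definition hamiltonian_vf ::
  "('m, 'e::euclidean_space) chart set \<Rightarrow> ('m, 'e) dform \<Rightarrow> ('m, 'e) dform
     \<Rightarrow> ('m \<Rightarrow> real) \<Rightarrow> 'm \<Rightarrow> 'e" where
  "hamiltonian_vf A \<eta> \<omega> H x = (THE w. \<forall>v. \<omega> x [w, v] = lee_deriv A \<eta> 0 (form0 H) x [v])"

definition integral_curve ::
  "('m::topological_space, 'e::euclidean_space) chart set \<Rightarrow> ('m \<Rightarrow> 'e) \<Rightarrow> real set
     \<Rightarrow> (real \<Rightarrow> 'm) \<Rightarrow> bool" where
  "integral_curve A X J \<gamma> \<longleftrightarrow> open J \<and> is_interval J \<and> continuous_on J \<gamma> \<and>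
     (\<forall>t\<in>J. ((\<lambda>s. cmap (chart_at A (\<gamma> t)) (\<gamma> s)) has_vector_derivative X (\<gamma> t)) (at t))"

text \<open>The flow need not be complete: \<open>flow_domain A X x\<close> is the maximal interval of definition of
  the orbit of \<open>x\<close>.\<close>

definition flow_domain ::
  "('m::topological_space, 'e::euclidean_space) chart set \<Rightarrow> ('m \<Rightarrow> 'e) \<Rightarrow> 'm \<Rightarrow> real set" where
  "flow_domain A X x = {t. \<exists>J \<gamma>. integral_curve A X J \<gamma> \<and> 0 \<in> J \<and> t \<in> J \<and> \<gamma> 0 = x}"

definition flow ::
  "('m::topological_space, 'e::euclidean_space) chart set \<Rightarrow> ('m \<Rightarrow> 'e) \<Rightarrow> real \<Rightarrow> 'm \<Rightarrow> 'm" where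
  "flow A X t x = (THE y. \<exists>J \<gamma>. integral_curve A X J \<gamma> \<and> 0 \<in> J \<and> t \<in> J \<and> \<gamma> 0 = x \<and> \<gamma> t = y)"

definition flow_invariant ::
  "('m::topological_space, 'e::euclidean_space) chart set \<Rightarrow> ('m \<Rightarrow> 'e) \<Rightarrow> 'm set \<Rightarrow> bool" where
  "flow_invariant A X L \<longleftrightarrow> (\<forall>x\<in>L. \<forall>t\<in>flow_domain A X x. flow A X t x \<in> L)"

text \<open>Orbits starting in \<open>L\<close> stay in \<open>L\<close> for a short time. For a set \<open>L\<close> that is not closed this is
  weaker than \<open>flow_invariant\<close>: the orbits may leave \<open>L\<close> through its frontier.\<close>

definition locally_flow_invariant ::
  "('m::topological_space, 'e::euclidean_space) chart set \<Rightarrow> ('m \<Rightarrow> 'e) \<Rightarrow> 'm set \<Rightarrow> bool" where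
  "locally_flow_invariant A X L \<longleftrightarrow>
     (\<forall>x\<in>L. \<exists>e>0. \<forall>t\<in>flow_domain A X x. \<bar>t\<bar> < e \<longrightarrow> flow A X t x \<in> L)"


section \<open>Submanifolds\<close>

text \<open>Embedded submanifolds without boundary, not necessarily closed as subsets.\<close>

definition submanifold ::
  "('m::{t2_space, second_countable_topology}, 'e::euclidean_space) chart set \<Rightarrow> nat \<Rightarrow> 'm set \<Rightarrow> bool" where
  "submanifold A d L \<longleftrightarrow> (\<forall>x\<in>L. \<exists>c\<in>maximal_atlas A. \<exists>V. x \<in> cdom c \<and> subspace V \<and> dim V = d \<and>
     cmap c ` (cdom c \<inter> L) = cmap c ` cdom c \<inter> V)"

text \<open>Velocities at \<open>x\<close> of the smooth curves that run in \<open>L\<close>.\<close>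

definition tangent_space ::
  "('m, 'e::euclidean_space) chart set \<Rightarrow> 'm set \<Rightarrow> 'm \<Rightarrow> 'e set" where
  "tangent_space A L x = {v. \<exists>e>0. \<exists>\<gamma>::real \<Rightarrow> 'm. \<gamma> 0 = x \<and>
     \<gamma> ` {-e<..<e} \<subseteq> L \<inter> cdom (chart_at A x) \<and>
     smooth_on {-e<..<e} (cmap (chart_at A x) \<circ> \<gamma>) \<and>
     ((cmap (chart_at A x) \<circ> \<gamma>) has_vector_derivative v) (at 0)}"

definition orthogonal_space :: "'e mform \<Rightarrow> 'e set \<Rightarrow> 'e set" where
  "orthogonal_space \<omega> W = {u. \<forall>v\<in>W. \<omega> [u, v] = 0}"

definition isotropic_at ::
  "('m, 'e::euclidean_space) chart set \<Rightarrow> ('m, 'e) dform \<Rightarrow> 'm set \<Rightarrow> 'm \<Rightarrow> bool" where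
  "isotropic_at A \<omega> L x \<longleftrightarrow> tangent_space A L x \<subseteq> orthogonal_space (\<omega> x) (tangent_space A L x)"

definition isotropic ::
  "('m, 'e::euclidean_space) chart set \<Rightarrow> ('m, 'e) dform \<Rightarrow> 'm set \<Rightarrow> bool" where
  "isotropic A \<omega> L \<longleftrightarrow> (\<forall>x\<in>L. isotropic_at A \<omega> L x)"

definition coisotropic ::
  "('m, 'e::euclidean_space) chart set \<Rightarrow> ('m, 'e) dform \<Rightarrow> 'm set \<Rightarrow> bool" where
  "coisotropic A \<omega> L \<longleftrightarrow>
     (\<forall>x\<in>L. orthogonal_space (\<omega> x) (tangent_space A L x) \<subseteq> tangent_space A L x)"

definition hamiltonian_distribution ::
  "('m, 'e::euclidean_space) chart set \<Rightarrow> ('m, 'e) dform \<Rightarrow> ('m \<Rightarrow> real) \<Rightarrow> 'm \<Rightarrow> 'e set" where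
  "hamiltonian_distribution A \<eta> H x = {v. lee_deriv A \<eta> 0 (form0 H) x [v] = 0}"

definition tangent_to ::
  "('m, 'e::euclidean_space) chart set \<Rightarrow> ('m \<Rightarrow> 'e set) \<Rightarrow> 'm set \<Rightarrow> bool" where
  "tangent_to A F L \<longleftrightarrow> (\<forall>x\<in>L. tangent_space A L x \<subseteq> F x)"

definition pullback_degenerate_at ::
  "('m, 'e::euclidean_space) chart set \<Rightarrow> ('m, 'e) dform \<Rightarrow> 'm set \<Rightarrow> 'm \<Rightarrow> bool" where
  "pullback_degenerate_at A \<omega> L x \<longleftrightarrow>
     (\<exists>u\<in>tangent_space A L x. u \<noteq> 0 \<and> (\<forall>v\<in>tangent_space A L x. \<omega> x [u, v] = 0))"

text \<open>The pull-back to \<open>L\<close> of the \<open>p\<close>-form \<open>\<alpha>\<close> is zero at the point \<open>x\<close>.\<close>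

definition pullback_zero_at ::
  "('m, 'e::euclidean_space) chart set \<Rightarrow> nat \<Rightarrow> ('m, 'e) dform \<Rightarrow> 'm set \<Rightarrow> 'm \<Rightarrow> bool" where
  "pullback_zero_at A p \<alpha> L x \<longleftrightarrow>
     (\<forall>vs. length vs = p \<and> set vs \<subseteq> tangent_space A L x \<longrightarrow> \<alpha> x vs = 0)"

text \<open>The points of \<open>L\<close> that are limits of points of \<open>L\<close> at which \<open>\<F>\<close> is a hyperplane,
  i.e. at which \<open>d\<^sub>\<eta>H\<close> does not vanish. Where \<open>d\<^sub>\<eta>H\<close> vanishes, every submanifold
  is tangent to \<open>\<F>\<close> and its points are fixed by the flow: for \<open>H = 0\<close> any submanifold,
  such as the whole manifold, is invariant and tangent to \<open>\<F>\<close>, whatever the pull-back of \<open>\<omega>\<close>.\<close>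

definition regular_closure ::
  "('m::topological_space, 'e::euclidean_space) chart set \<Rightarrow> ('m, 'e) dform \<Rightarrow> ('m \<Rightarrow> real)
     \<Rightarrow> 'm set \<Rightarrow> 'm set" where
  "regular_closure A \<eta> H L = L \<inter> closure {x\<in>L. hamiltonian_distribution A \<eta> H x \<noteq> UNIV}"

end

theory Submission
  imports Defs
begin

text \<open>
  Everything rests on the identity \<open>\<omega>(X, v) = d\<^sub>\<eta>H(v)\<close>: the distribution \<open>\<F> = ker d\<^sub>\<eta>H\<close> is the
  \<open>\<omega>\<close>-orthogonal of \<open>X\<close>, and \<open>d\<^sub>\<eta>H\<close> vanishes where \<open>X\<close> does. Three consequences follow.

  If \<open>L\<close> is isotropic and \<open>X\<close> is tangent to \<open>L\<close>, then \<open>d\<^sub>\<eta>H(v) = \<omega>(X, v) = 0\<close> for \<open>v\<close> in \<open>TL\<close>. If \<open>L\<close> is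
  tangent to \<open>\<F>\<close>, then \<open>X\<close> lies in \<open>TL\<^sup>\<omega>\<close>, hence in \<open>TL\<close> when \<open>L\<close> is coisotropic. If \<open>X\<close> is tangent to
  \<open>L\<close> and \<open>L\<close> is tangent to \<open>\<F>\<close>, then \<open>X\<close> spans a direction in the kernel of the pull-back of \<open>\<omega>\<close>
  wherever \<open>d\<^sub>\<eta>H\<close> is not zero; degeneracy of the pull-back is a closed condition, so it passes to limits
  (\<open>pullback_degenerate_on_regular_closure\<close>). Finally, an alternating form of degree \<open>dim W\<close> that
  vanishes whenever a fixed nonzero vector of \<open>W\<close> is inserted vanishes on \<open>W\<close>
  (\<open>alternating_form_eq_zero_if_kernel\<close>); applied to \<open>\<omega>\<^sup>k\<close>, and to \<open>\<omega>\<close> itself when \<open>L\<close> is a surface, this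
  gives the last two claims.

  What remains is to pass between invariance under the flow and tangency of \<open>X\<close>. In a chart, \<open>X\<close> is
  the solution of a linear system with smooth coefficients, so it is locally Lipschitz
  (\<open>lipschitz_vf_X\<^sub>H\<close>). Orbits therefore exist (\<open>integral_curve_exists\<close>) and are unique
  (\<open>integral_curve_unique\<close>). If \<open>L\<close> is invariant, the orbit of a point of \<open>L\<close> is a curve in \<open>L\<close>, and its
  velocity \<open>X\<close> is tangent to \<open>L\<close> (\<open>invariant_imp_vf_tangent\<close>). Conversely, let \<open>X\<close> be tangent to \<open>L\<close>, and let
  \<open>P\<close> be a linear projection onto the subspace \<open>V\<close> that represents \<open>L\<close> in a slice chart. Along an orbit
  \<open>y\<close> in that chart, \<open>z = y - P y\<close> satisfies \<open>|z'| \<le> K |z|\<close>, because the coordinate expression of \<open>X\<close> at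
  \<open>P y\<close> lies in \<open>V\<close>; hence \<open>z\<close> stays zero if it once is (\<open>vf_tangent_imp_stays_near\<close>).

  The tangent space of \<open>L\<close> is defined by smooth curves, but orbits need not be known to be smooth:
  in a slice chart every vector of \<open>V\<close> is the velocity of a straight line, and the velocity of any
  differentiable curve in \<open>V\<close> lies in \<open>V\<close> (\<open>tangent_space_slice\<close>, \<open>velocity_in_subspace\<close>).
\<close>

section \<open>Locally Lipschitz maps\<close>

text \<open>The property is attached to a point and not to a set, so that compositions and coordinate changes
  need no bookkeeping of domains: what a map does away from the point is irrelevant.\<close>

definition lipschitz_near :: "'a::metric_space \<Rightarrow> ('a \<Rightarrow> 'b::metric_space) \<Rightarrow> bool" where
  "lipschitz_near x f \<longleftrightarrow> (\<exists>e>0. \<exists>K. K-lipschitz_on (ball x e) f)"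

lemma lipschitz_nearE:
  assumes "lipschitz_near x f" "open S" "x \<in> S"
  obtains e K where "e > 0" "K-lipschitz_on (ball x e) f" "ball x e \<subseteq> S"
proof -
  obtain e1 K where 1: "e1 > 0" "K-lipschitz_on (ball x e1) f"
    using assms(1) unfolding lipschitz_near_def by blast
  obtain e2 where 2: "e2 > 0" "ball x e2 \<subseteq> S"
    using assms(2,3) openE by blast
  show thesis
  proof (rule that[of "min e1 e2" K])
    show "K-lipschitz_on (ball x (min e1 e2)) f"
      by (rule lipschitz_on_subset[OF 1(2)]) auto
  qed (use 1 2 in auto)
qed

lemma lipschitz_near_continuous:
  assumes "lipschitz_near x f"
  shows "isCont f x"
proof -
  obtain e K where "e > 0" "K-lipschitz_on (ball x e) f"
    using assms unfolding lipschitz_near_def by blast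
  then have "continuous_on (ball x e) f"
    by (auto intro: lipschitz_on_continuous_on)
  then show ?thesis
    using \<open>e > 0\<close> continuous_on_eq_continuous_at[OF open_ball] by force
qed

lemma lipschitz_near_transform:
  assumes "lipschitz_near x f" "open S" "x \<in> S" "\<And>y. y \<in> S \<Longrightarrow> f y = g y"
  shows "lipschitz_near x g"
proof -
  obtain e K where 1: "e > 0" "K-lipschitz_on (ball x e) f" "ball x e \<subseteq> S"
    using lipschitz_nearE[OF assms(1-3)] .
  have "K-lipschitz_on (ball x e) g"
    using 1(2) by (rule lipschitz_on_transform) (use 1 assms(4) in auto)
  then show ?thesis
    using 1(1) unfolding lipschitz_near_def by blast
qed

lemma lipschitz_near_compose:
  assumes f: "lipschitz_near x f" and g: "lipschitz_near (f x) g"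
  shows "lipschitz_near x (\<lambda>y. g (f y))"
proof -
  obtain d M where M: "d > 0" "M-lipschitz_on (ball (f x) d) g"
    using g unfolding lipschitz_near_def by blast
  obtain e0 K0 where "e0 > 0" and K0: "K0-lipschitz_on (ball x e0) f"
    using f unfolding lipschitz_near_def by blast
  define e where "e = min e0 (d / (K0 + 1))"
  have "K0 \<ge> 0"
    using K0 by (rule lipschitz_on_nonneg)
  then have "e > 0"
    using \<open>e0 > 0\<close> M(1) by (simp add: e_def)
  have Kf: "K0-lipschitz_on (ball x e) f"
    using K0 by (rule lipschitz_on_subset) (auto simp: e_def)
  have "f ` ball x e \<subseteq> ball (f x) d"
  proof safe
    fix y assume y: "y \<in> ball x e"
    have "dist (f x) (f y) \<le> K0 * dist x y"
      using lipschitz_onD[OF Kf _ y] \<open>e > 0\<close> by simp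
    also have "\<dots> \<le> (K0 + 1) * dist x y"
      by (simp add: mult_right_mono)
    also have "\<dots> < (K0 + 1) * (d / (K0 + 1))"
      using y \<open>K0 \<ge> 0\<close> by (intro mult_strict_left_mono) (auto simp: e_def)
    finally show "f y \<in> ball (f x) d"
      using \<open>K0 \<ge> 0\<close> by simp
  qed
  then have "M-lipschitz_on (f ` ball x e) g"
    by (rule lipschitz_on_subset[OF M(2)])
  then have "(M * K0)-lipschitz_on (ball x e) (\<lambda>y. g (f y))"
    by (rule lipschitz_on_compose2[OF Kf])
  then show ?thesis
    using \<open>e > 0\<close> unfolding lipschitz_near_def by blast
qed

lemma lipschitz_near_const [simp]: "lipschitz_near x (\<lambda>_. c)"
  unfolding lipschitz_near_def by (intro exI[of _ 1] exI[of _ 0] conjI lipschitz_on_constant) simp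

lemma lipschitz_near_bounded_linear:
  assumes "bounded_linear f"
  shows "lipschitz_near x f"
proof -
  obtain C where "C-lipschitz_on UNIV f"
    using bounded_linear.lipschitz_boundE[OF assms] .
  then have "C-lipschitz_on (ball x 1) f"
    by (rule lipschitz_on_subset) simp
  then show ?thesis
    unfolding lipschitz_near_def by (meson zero_less_one)
qed

lemma lipschitz_near_add:
  fixes f g :: "'a::metric_space \<Rightarrow> 'b::real_normed_vector"
  assumes "lipschitz_near x f" "lipschitz_near x g"
  shows "lipschitz_near x (\<lambda>y. f y + g y)"
proof -
  obtain e K where 1: "e > 0" "K-lipschitz_on (ball x e) f"
    using assms(1) unfolding lipschitz_near_def by blast
  obtain d M where 2: "d > 0" "M-lipschitz_on (ball x d) g" "ball x d \<subseteq> ball x e"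
    using lipschitz_nearE[OF assms(2) open_ball, of x e] 1(1) by auto
  have "(K + M)-lipschitz_on (ball x d) (\<lambda>y. f y + g y)"
    by (rule lipschitz_on_add[OF lipschitz_on_subset[OF 1(2) 2(3)] 2(2)])
  then show ?thesis
    using 2(1) unfolding lipschitz_near_def by blast
qed

lemma lipschitz_near_sum:
  fixes f :: "'i \<Rightarrow> 'a::metric_space \<Rightarrow> 'b::real_normed_vector"
  assumes "\<And>i. i \<in> I \<Longrightarrow> lipschitz_near x (f i)"
  shows "lipschitz_near x (\<lambda>y. \<Sum>i\<in>I. f i y)"
  using assms
proof (induction I rule: infinite_finite_induct)
  case (insert i I)
  then show ?case
    using lipschitz_near_add[of x "f i" "\<lambda>y. \<Sum>i\<in>I. f i y"] by simp
qed auto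

text \<open>Near the point both factors are bounded, being Lipschitz on a bounded set, so the product rule
  \<open>f y g y - f z g z = f y (g y - g z) + (f y - f z) g z\<close> gives a Lipschitz bound.\<close>

lemma lipschitz_near_scaleR:
  fixes f :: "'a::metric_space \<Rightarrow> real" and g :: "'a \<Rightarrow> 'b::real_normed_vector"
  assumes "lipschitz_near x f" "lipschitz_near x g"
  shows "lipschitz_near x (\<lambda>y. f y *\<^sub>R g y)"
proof -
  obtain e K where 1: "e > 0" "K-lipschitz_on (ball x e) f"
    using assms(1) unfolding lipschitz_near_def by blast
  obtain d0 M where 2: "d0 > 0" "M-lipschitz_on (ball x d0) g" "ball x d0 \<subseteq> ball x e"
    using lipschitz_nearE[OF assms(2) open_ball, of x e] 1(1) by auto
  define d where "d = min d0 1"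
  have d: "d > 0" "d \<le> 1" and sub: "ball x d \<subseteq> ball x d0"
    using 2(1) by (auto simp: d_def)
  have K: "K-lipschitz_on (ball x d) f" and M: "M-lipschitz_on (ball x d) g"
    using lipschitz_on_subset[OF 1(2)] lipschitz_on_subset[OF 2(2)] 2(3) sub by blast+
  have K0: "K \<ge> 0" and M0: "M \<ge> 0"
    using K M by (auto dest: lipschitz_on_nonneg)
  define A where "A = norm (f x) + K"
  define B where "B = norm (g x) + M"
  have fA: "norm (f y) \<le> A" and gB: "norm (g y) \<le> B" if "y \<in> ball x d" for y
  proof -
    have *: "dist y x \<le> 1"
      using that d(2) by (simp add: dist_commute)
    have "norm (f y - f x) \<le> K * dist y x" "norm (g y - g x) \<le> M * dist y x"
      using lipschitz_onD[OF K that, of x] lipschitz_onD[OF M that, of x] d(1)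
      by (auto simp: dist_norm)
    moreover have "K * dist y x \<le> K * 1" "M * dist y x \<le> M * 1"
      using K0 M0 * by (intro mult_left_mono; simp)+
    ultimately show "norm (f y) \<le> A" "norm (g y) \<le> B"
      using norm_triangle_sub[of "f y" "f x"] norm_triangle_sub[of "g y" "g x"]
      by (auto simp: A_def B_def)
  qed
  have "(A * M + K * B)-lipschitz_on (ball x d) (\<lambda>y. f y *\<^sub>R g y)"
  proof (rule lipschitz_onI)
    fix y z assume y: "y \<in> ball x d" and z: "z \<in> ball x d"
    have "f y *\<^sub>R g y - f z *\<^sub>R g z = f y *\<^sub>R (g y - g z) + (f y - f z) *\<^sub>R g z"
      by (simp add: algebra_simps)
    then have "dist (f y *\<^sub>R g y) (f z *\<^sub>R g z) \<le> norm (f y) * dist (g y) (g z) + dist (f y) (f z) * norm (g z)"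
      by (metis dist_norm norm_scaleR norm_triangle_ineq real_norm_def)
    also have "\<dots> \<le> A * (M * dist y z) + (K * dist y z) * B"
      using fA[OF y] gB[OF z] lipschitz_onD[OF K y z] lipschitz_onD[OF M y z] K0 M0
      by (intro add_mono mult_mono) (auto simp: A_def)
    finally show "dist (f y *\<^sub>R g y) (f z *\<^sub>R g z) \<le> (A * M + K * B) * dist y z"
      by (simp add: algebra_simps)
  qed (auto simp: A_def B_def K0 M0)
  then show ?thesis
    using d(1) unfolding lipschitz_near_def by blast
qed

text \<open>A family of linear maps is controlled by its values on the finitely many basis vectors. This
  avoids any topology on the space of linear maps.\<close>

lemma lipschitz_near_componentwise:
  fixes f :: "'a::metric_space \<Rightarrow> 'b::euclidean_space \<Rightarrow> 'c::real_normed_vector"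
  assumes lin: "\<And>y. y \<in> S \<Longrightarrow> linear (f y)" and S: "open S" "x \<in> S"
    and f: "\<And>b. b \<in> Basis \<Longrightarrow> lipschitz_near x (\<lambda>y. f y b)"
    and g: "lipschitz_near x g"
  shows "lipschitz_near x (\<lambda>y. f y (g y))"
proof (rule lipschitz_near_transform[OF _ S])
  show "lipschitz_near x (\<lambda>y. \<Sum>b\<in>Basis. (g y \<bullet> b) *\<^sub>R f y b)"
    by (intro lipschitz_near_sum lipschitz_near_scaleR f
        lipschitz_near_compose[OF g lipschitz_near_bounded_linear[OF bounded_linear_inner_left]])
  fix y assume "y \<in> S"
  have "f y (\<Sum>b\<in>Basis. (g y \<bullet> b) *\<^sub>R b) = (\<Sum>b\<in>Basis. (g y \<bullet> b) *\<^sub>R f y b)"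
    using lin[OF \<open>y \<in> S\<close>] by (simp add: linear_sum linear_scale)
  then show "(\<Sum>b\<in>Basis. (g y \<bullet> b) *\<^sub>R f y b) = f y (g y)"
    by (simp add: euclidean_representation)
qed

text \<open>Compose with a left inverse of \<open>M x\<close>, so that the system becomes \<open>N y (Y y) = G (c y)\<close> with
  \<open>N x\<close> the identity. Close to \<open>x\<close> the map \<open>N y\<close> differs from the identity by at most \<open>1/2\<close> in norm,
  hence \<open>|u| \<le> 2 |N y u|\<close>; this bounds \<open>Y\<close> and then, through
  \<open>N y (Y y - Y z) = (G (c y) - G (c z)) - (N y - N z) (Y z)\<close>, its increments.\<close>

lemma lipschitz_near_linear_solution:
  fixes M :: "'a::metric_space \<Rightarrow> 'b::euclidean_space \<Rightarrow> 'c::euclidean_space"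
  assumes lin: "\<And>y. y \<in> S \<Longrightarrow> linear (M y)" and S: "open S" "x \<in> S"
    and M: "\<And>b. b \<in> Basis \<Longrightarrow> lipschitz_near x (\<lambda>y. M y b)"
    and c: "lipschitz_near x c"
    and sol: "\<And>y. y \<in> S \<Longrightarrow> M y (Y y) = c y"
    and inj: "inj (M x)"
  shows "lipschitz_near x Y"
proof -
  obtain G where G: "linear G" and GM: "\<And>u. G (M x u) = u"
    using linear_injective_left_inverse[OF lin[OF S(2)] inj] by (auto simp: fun_eq_iff)
  have GL: "lipschitz_near z G" for z
    using G by (simp add: lipschitz_near_bounded_linear linear_conv_bounded_linear)
  define N where "N y u = G (M y u)" for y u
  have Nlin: "linear (N y)" if "y \<in> S" for y
    unfolding N_def using linear_compose[OF lin[OF that] G] by (simp add: comp_def)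
  have "\<forall>b\<in>Basis. \<exists>e>0. \<exists>K. K-lipschitz_on (ball x e) (\<lambda>y. N y b)"
    using lipschitz_near_compose[OF M GL] unfolding N_def lipschitz_near_def by blast
  then obtain e K where e: "\<And>b. b \<in> Basis \<Longrightarrow> e b > (0::real)"
      and K: "\<And>b. b \<in> Basis \<Longrightarrow> (K b)-lipschitz_on (ball x (e b)) (\<lambda>y. N y b)"
    by metis
  have "lipschitz_near x (\<lambda>y. G (c y))"
    by (rule lipschitz_near_compose[OF c GL])
  then obtain e0 C where e0: "e0 > 0" "C-lipschitz_on (ball x e0) (\<lambda>y. G (c y))" "ball x e0 \<subseteq> S"
    using lipschitz_nearE S by blast
  define K1 where "K1 = (\<Sum>b\<in>Basis. K b)"
  have K1: "K1 \<ge> 0"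
    unfolding K1_def by (rule sum_nonneg) (use K lipschitz_on_nonneg in blast)
  have C: "C \<ge> 0"
    using e0(2) by (rule lipschitz_on_nonneg)
  define d where "d = Min (insert (1 / (2 * (K1 + 1))) (insert e0 (e ` Basis)))"
  have d: "d > 0" "d \<le> 1 / (2 * (K1 + 1))" "d \<le> e0"
    using e e0(1) K1 unfolding d_def by (auto simp: Min_gr_iff)
  have d': "d \<le> e b" if "b \<in> Basis" for b
    unfolding d_def using that by (intro Min_le) auto
  have Nd: "norm (N y u - N z u) \<le> K1 * dist y z * norm u" if "y \<in> ball x d" "z \<in> ball x d" for y z u
  proof -
    have yz: "y \<in> S" "z \<in> S"
      using that d(3) e0(3) by auto
    have "N y u - N z u = (\<Sum>b\<in>Basis. (u \<bullet> b) *\<^sub>R (N y b - N z b))"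
      using Nlin[OF yz(1)] Nlin[OF yz(2)]
      by (subst (1 2) euclidean_representation[of u, symmetric])
        (simp add: linear_sum linear_scale sum_subtractf scaleR_diff_right)
    also have "norm \<dots> \<le> (\<Sum>b\<in>Basis. norm u * (K b * dist y z))"
    proof (rule sum_norm_le)
      fix b :: 'b assume b: "b \<in> Basis"
      have "dist (N y b) (N z b) \<le> K b * dist y z"
        by (rule lipschitz_onD[OF K[OF b]]) (use that d'[OF b] in auto)
      then show "norm ((u \<bullet> b) *\<^sub>R (N y b - N z b)) \<le> norm u * (K b * dist y z)"
        using Basis_le_norm[OF b, of u] by (auto simp: dist_norm intro!: mult_mono)
    qed
    finally show ?thesis
      by (simp add: K1_def sum_distrib_left sum_distrib_right mult_ac)
  qed
  have low: "norm u \<le> 2 * norm (N y u)" if y: "y \<in> ball x d" for y u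
  proof -
    have "K1 * dist x y \<le> K1 * (1 / (2 * (K1 + 1)))"
      using y d(2) K1 by (intro mult_left_mono) auto
    also have "\<dots> \<le> 1 / 2"
      using K1 by (simp add: divide_simps)
    finally have "K1 * dist x y * norm u \<le> 1 / 2 * norm u"
      by (rule mult_right_mono) simp
    moreover have "norm (N x u - N y u) \<le> K1 * dist x y * norm u"
      using Nd y d(1) by simp
    moreover have "N x u = u"
      by (simp add: N_def GM)
    ultimately show ?thesis
      using norm_triangle_sub[of u "N y u"] by simp
  qed
  have NY: "N y (Y y) = G (c y)" if "y \<in> ball x d" for y
  proof -
    have "y \<in> S"
      using that d(3) e0(3) by auto
    then show ?thesis
      by (simp add: N_def sol)
  qed
  define B where "B = 2 * (norm (G (c x)) + C * d)"
  have B: "norm (Y y) \<le> B" if y: "y \<in> ball x d" for y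
  proof -
    have "dist (G (c y)) (G (c x)) \<le> C * dist y x"
      by (rule lipschitz_onD[OF e0(2)]) (use y d in auto)
    also have "\<dots> \<le> C * d"
      using y C by (intro mult_left_mono) (auto simp: dist_commute)
    finally have "norm (G (c y)) \<le> norm (G (c x)) + C * d"
      using norm_triangle_sub[of "G (c y)" "G (c x)"] by (simp add: dist_norm)
    then show ?thesis
      using low[OF y, of "Y y"] NY[OF y] by (simp add: B_def)
  qed
  have "(2 * (C + K1 * B))-lipschitz_on (ball x d) Y"
  proof (rule lipschitz_onI)
    fix y z assume y: "y \<in> ball x d" and z: "z \<in> ball x d"
    have yS: "y \<in> S"
      using y d(3) e0(3) by auto
    have "N y (Y y - Y z) = (G (c y) - G (c z)) - (N y (Y z) - N z (Y z))"
      using NY[OF y] NY[OF z] linear_diff[OF Nlin[OF yS]] by simp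
    then have "norm (N y (Y y - Y z)) \<le> norm (G (c y) - G (c z)) + norm (N y (Y z) - N z (Y z))"
      by (simp add: norm_triangle_ineq4)
    also have "\<dots> \<le> C * dist y z + K1 * dist y z * B"
    proof (rule add_mono)
      show "norm (G (c y) - G (c z)) \<le> C * dist y z"
        using lipschitz_onD[OF e0(2), of y z] y z d(3) by (simp add: dist_norm)
      show "norm (N y (Y z) - N z (Y z)) \<le> K1 * dist y z * B"
        by (rule order_trans[OF Nd[OF y z]]) (use B[OF z] K1 in \<open>auto intro: mult_left_mono\<close>)
    qed
    finally show "dist (Y y) (Y z) \<le> 2 * (C + K1 * B) * dist y z"
      using low[OF y, of "Y y - Y z"] by (simp add: dist_norm algebra_simps)
  qed (use C K1 B[of x] d(1) in \<open>auto simp: B_def\<close>)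
  then show ?thesis
    using d(1) unfolding lipschitz_near_def by blast
qed

lemma linear_of_components:
  fixes f :: "'a::real_vector \<Rightarrow> 'b::euclidean_space \<Rightarrow> real"
  assumes "\<And>b. linear (\<lambda>u. f u b)"
  shows "linear (\<lambda>u. \<Sum>b\<in>Basis. f u b *\<^sub>R b)"
  by (rule linearI)
    (simp_all add: linear_add[OF assms] linear_scale[OF assms] scaleR_left_distrib sum.distrib scaleR_sum_right)

lemma eq_zero_if_basis:
  fixes f :: "'a::euclidean_space \<Rightarrow> 'b::real_vector"
  assumes "linear f" "\<And>b. b \<in> Basis \<Longrightarrow> f b = 0"
  shows "f v = 0"
  using linear_eq_on_span[of f "\<lambda>_. 0" Basis v] assms by (simp add: linear_iff)

lemma smooth_on_differentiable: "smooth_on S f \<Longrightarrow> x \<in> S \<Longrightarrow> f differentiable (at x)"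
  unfolding smooth_on_def using Ck_on.simps(2) by blast

lemma smooth_on_derivative: "smooth_on S f \<Longrightarrow> smooth_on S (\<lambda>x. frechet_derivative f (at x) v)"
  unfolding smooth_on_def using Ck_on.simps(2) by blast

lemma smooth_on_continuous_on: "smooth_on S f \<Longrightarrow> continuous_on S f"
  unfolding smooth_on_def using Ck_on.simps(1) by blast

text \<open>The partial derivatives are continuous, hence bounded on a compact ball, and the mean value
  inequality on that ball applies.\<close>

lemma smooth_on_imp_lipschitz_near:
  fixes f :: "'a::euclidean_space \<Rightarrow> 'b::real_normed_vector"
  assumes f: "smooth_on S f" and S: "open S" "x \<in> S"
  shows "lipschitz_near x f"
proof -
  obtain r where r: "r > 0" "cball x r \<subseteq> S"
    using S open_contains_cball by blast
  let ?D = "\<lambda>y. frechet_derivative f (at y)"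
  have "\<exists>B. \<forall>y\<in>cball x r. norm (?D y b) \<le> B" for b
  proof -
    have "continuous_on (cball x r) (\<lambda>y. ?D y b)"
      using smooth_on_continuous_on[OF smooth_on_derivative[OF f]] r(2) continuous_on_subset by blast
    then have "bounded ((\<lambda>y. ?D y b) ` cball x r)"
      by (intro compact_imp_bounded compact_continuous_image) auto
    then show ?thesis
      by (auto simp: bounded_iff)
  qed
  then obtain B where B: "\<And>b y. y \<in> cball x r \<Longrightarrow> norm (?D y b) \<le> B b"
    by metis
  define C where "C = (\<Sum>b\<in>Basis. B b)"
  have der: "(f has_derivative ?D y) (at y)" if "y \<in> cball x r" for y
    using smooth_on_differentiable[OF f] that r(2) frechet_derivative_works by blast
  have "C \<ge> 0"
    unfolding C_def using B[of x] r(1) by (intro sum_nonneg) (meson centre_in_cball less_imp_le norm_ge_zero order_trans)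
  have D: "onorm (?D y) \<le> C" if y: "y \<in> cball x r" for y
  proof (rule onorm_bound)
    fix v
    have lin: "linear (?D y)"
      using der[OF y] by (rule has_derivative_linear)
    have "?D y v = (\<Sum>b\<in>Basis. (v \<bullet> b) *\<^sub>R ?D y b)"
      by (subst euclidean_representation[of v, symmetric]) (simp add: linear_sum[OF lin] linear_scale[OF lin])
    also have "norm \<dots> \<le> (\<Sum>b\<in>Basis. norm v * B b)"
      by (rule sum_norm_le) (use B[OF y] Basis_le_norm in \<open>auto intro!: mult_mono\<close>)
    finally show "norm (?D y v) \<le> C * norm v"
      by (simp add: C_def sum_distrib_left mult.commute)
  qed fact
  have "C-lipschitz_on (ball x r) f"
  proof (rule lipschitz_onI)
    fix y z assume yz: "y \<in> ball x r" "z \<in> ball x r"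
    show "dist (f y) (f z) \<le> C * dist y z"
      unfolding dist_norm
    proof (rule differentiable_bound[OF convex_ball _ _ yz])
      show "(f has_derivative ?D w) (at w within ball x r)" if "w \<in> ball x r" for w
        using der[of w] that has_derivative_at_withinI by auto
      show "onorm (?D w) \<le> C" if "w \<in> ball x r" for w
        using D[of w] that by auto
    qed
  qed fact
  then show ?thesis
    using r(1) unfolding lipschitz_near_def by blast
qed

section \<open>Smooth maps along straight lines\<close>

lemma Ck_on_cong:
  assumes "open S" "\<And>x. x \<in> S \<Longrightarrow> f x = g x" "Ck_on k S f"
  shows "Ck_on k S g"
  using assms(2,3)
proof (induction k arbitrary: f g)
  case 0
  then show ?case
    using continuous_on_cong by fastforce
next
  case (Suc k)
  have eq: "frechet_derivative f (at x) = frechet_derivative g (at x)" if "x \<in> S" for x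
    by (rule frechet_derivative_transform_within_open[OF _ assms(1) that]) (use Suc that in auto)
  show ?case
    unfolding Ck_on.simps
  proof (intro conjI ballI allI)
    fix x assume x: "x \<in> S"
    then obtain f' where "(f has_derivative f') (at x)"
      using Suc.prems(2) by (auto simp: differentiable_def)
    then have "(g has_derivative f') (at x)"
      by (rule has_derivative_transform_within_open[OF _ assms(1) x]) (rule Suc.prems(1))
    then show "g differentiable at x"
      by (auto simp: differentiable_def)
  next
    fix v
    show "Ck_on k S (\<lambda>x. frechet_derivative g (at x) v)"
      by (rule Suc.IH[of "\<lambda>x. frechet_derivative f (at x) v"]) (use Suc.prems eq in auto)
  qed
qed

text \<open>Straight lines suffice for the tangent spaces of submanifolds. Their velocity is
  constant, so each derivative of the composite is again a directional derivative of \<open>f\<close> along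
  the line and the induction needs no product rule.\<close>

lemma Ck_on_compose_line:
  fixes f :: "'a::euclidean_space \<Rightarrow> 'b::real_normed_vector" and T :: "real set"
  assumes T: "open T" and sub: "\<And>t. t \<in> T \<Longrightarrow> p + t *\<^sub>R v \<in> S" and f: "Ck_on k S f"
  shows "Ck_on k T (\<lambda>t. f (p + t *\<^sub>R v))"
  using f
proof (induction k arbitrary: f)
  case 0
  then have "continuous_on S f"
    by simp
  then show ?case
    unfolding Ck_on.simps
    by (rule continuous_on_compose2) (use sub in \<open>auto intro!: continuous_intros\<close>)
next
  case (Suc k)
  have der: "((\<lambda>t. f (p + t *\<^sub>R v)) has_derivative
      (\<lambda>h. frechet_derivative f (at (p + t *\<^sub>R v)) (h *\<^sub>R v))) (at t)" if "t \<in> T" for t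
  proof -
    have "(f has_derivative frechet_derivative f (at (p + t *\<^sub>R v))) (at (p + t *\<^sub>R v))"
      using Suc.prems sub[OF that] frechet_derivative_works by auto
    moreover have "((\<lambda>t. p + t *\<^sub>R v) has_derivative (\<lambda>h. h *\<^sub>R v)) (at t)"
      by (auto intro!: derivative_eq_intros)
    ultimately show ?thesis
      using diff_chain_at[of "\<lambda>t. p + t *\<^sub>R v" _ t f] by (simp add: comp_def)
  qed
  show ?case
    unfolding Ck_on.simps
  proof (intro conjI ballI allI)
    fix t assume "t \<in> T"
    then show "(\<lambda>t. f (p + t *\<^sub>R v)) differentiable at t"
      using der differentiable_def by blast
  next
    fix h
    show "Ck_on k T (\<lambda>t. frechet_derivative (\<lambda>t. f (p + t *\<^sub>R v)) (at t) h)"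
    proof (rule Ck_on_cong[OF T])
      show "Ck_on k T (\<lambda>t. frechet_derivative f (at (p + t *\<^sub>R v)) (h *\<^sub>R v))"
        using Suc.IH[of "\<lambda>x. frechet_derivative f (at x) (h *\<^sub>R v)"] Suc.prems by simp
      show "frechet_derivative f (at (p + t *\<^sub>R v)) (h *\<^sub>R v) =
          frechet_derivative (\<lambda>t. f (p + t *\<^sub>R v)) (at t) h" if "t \<in> T" for t
        using frechet_derivative_at[OF der[OF that]] by metis
    qed
  qed
qed

lemma smooth_on_compose_line:
  fixes f :: "'a::euclidean_space \<Rightarrow> 'b::real_normed_vector" and T :: "real set"
  assumes "open T" "\<And>t. t \<in> T \<Longrightarrow> p + t *\<^sub>R v \<in> S" "smooth_on S f"
  shows "smooth_on T (\<lambda>t. f (p + t *\<^sub>R v))"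
  using assms Ck_on_compose_line unfolding smooth_on_def by blast

section \<open>Ordinary differential equations\<close>

text \<open>The function \<open>|z|\<^sup>2 exp (- 2 K t)\<close> has a derivative that is at most zero, vanishes at \<open>0\<close>, and is
  nonnegative.\<close>

lemma ode_zero_unique_right:
  fixes z :: "real \<Rightarrow> 'a::real_inner"
  assumes der: "\<And>t. 0 \<le> t \<Longrightarrow> t \<le> b \<Longrightarrow> (z has_vector_derivative z' t) (at t)"
    and bound: "\<And>t. 0 \<le> t \<Longrightarrow> t \<le> b \<Longrightarrow> norm (z' t) \<le> K * norm (z t)"
    and "z 0 = 0" "0 \<le> b"
  shows "z b = 0"
proof -
  define h where "h t = (z t \<bullet> z t) * exp (- (2 * K) * t)" for t
  have "h b \<le> h 0"
  proof (rule DERIV_nonpos_imp_nonincreasing[OF \<open>0 \<le> b\<close>])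
    fix t assume t: "0 \<le> t" "t \<le> b"
    have "(z has_derivative (\<lambda>s. s *\<^sub>R z' t)) (at t)"
      using der[OF t] by (simp add: has_vector_derivative_def)
    then have "((\<lambda>t. z t \<bullet> z t) has_derivative (\<lambda>s. z t \<bullet> (s *\<^sub>R z' t) + (s *\<^sub>R z' t) \<bullet> z t)) (at t)"
      by (intro has_derivative_inner)
    then have "((\<lambda>t. z t \<bullet> z t) has_real_derivative 2 * (z t \<bullet> z' t)) (at t)"
      unfolding has_field_derivative_def
      by (rule has_derivative_eq_rhs) (auto simp: inner_commute algebra_simps)
    then have "(h has_real_derivative
        2 * (z t \<bullet> z' t - K * (z t \<bullet> z t)) * exp (- (2 * K) * t)) (at t)"
      unfolding h_def by (rule DERIV_cong[OF DERIV_mult])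
        (auto intro!: derivative_eq_intros simp: algebra_simps)
    moreover have "z t \<bullet> z' t - K * (z t \<bullet> z t) \<le> 0"
    proof -
      have "z t \<bullet> z' t \<le> norm (z t) * norm (z' t)"
        by (rule norm_cauchy_schwarz)
      also have "\<dots> \<le> norm (z t) * (K * norm (z t))"
        by (intro mult_left_mono bound t) simp
      finally show ?thesis
        by (simp add: dot_square_norm power2_eq_square mult_ac)
    qed
    ultimately show "\<exists>y. (h has_real_derivative y) (at t) \<and> y \<le> 0"
      by (intro exI conjI) (auto intro!: mult_nonpos_nonneg)
  qed
  then have "(z b \<bullet> z b) * exp (- (2 * K) * b) \<le> 0"
    using \<open>z 0 = 0\<close> by (simp add: h_def)
  then have "z b \<bullet> z b \<le> 0"
    using mult_pos_pos[OF _ exp_gt_zero] not_le by blast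
  then show ?thesis
    using inner_gt_zero_iff[of "z b"] by linarith
qed

lemma ode_zero_unique:
  fixes z :: "real \<Rightarrow> 'a::real_inner"
  assumes der: "\<And>t. \<bar>t - a\<bar> < e \<Longrightarrow> (z has_vector_derivative z' t) (at t)"
    and bound: "\<And>t. \<bar>t - a\<bar> < e \<Longrightarrow> norm (z' t) \<le> K * norm (z t)"
    and "z a = 0" "\<bar>t - a\<bar> < e"
  shows "z t = 0"
proof -
  \<comment> \<open>Times before \<open>a\<close> are treated by reversing time.\<close>
  define c :: real where "c = (if a \<le> t then 1 else - 1)"
  define w where "w s = z (a + c * s)" for s
  have c: "\<bar>c\<bar> = 1" "t = a + c * \<bar>t - a\<bar>"
    by (auto simp: c_def)
  have in_range: "\<bar>a + c * s - a\<bar> < e" if "0 \<le> s" "s \<le> \<bar>t - a\<bar>" for s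
    using that assms(4) c(1) by (simp add: abs_mult)
  have "w \<bar>t - a\<bar> = 0"
  proof (rule ode_zero_unique_right)
    fix s assume s: "0 \<le> s" "s \<le> \<bar>t - a\<bar>"
    have "((\<lambda>s. a + c * s) has_real_derivative c) (at s)"
      by (auto intro!: derivative_eq_intros)
    then have "((\<lambda>s. a + c * s) has_vector_derivative c) (at s)"
      by (simp add: has_real_derivative_iff_has_vector_derivative)
    then have "(z \<circ> (\<lambda>s. a + c * s) has_vector_derivative c *\<^sub>R z' (a + c * s)) (at s)"
      by (rule vector_diff_chain_at) (rule der[OF in_range[OF s]])
    then show "(w has_vector_derivative c *\<^sub>R z' (a + c * s)) (at s)"
      by (simp add: comp_def w_def[abs_def])
    show "norm (c *\<^sub>R z' (a + c * s)) \<le> K * norm (w s)"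
      using bound[OF in_range[OF s]] c(1) by (simp add: w_def)
  qed (simp_all add: w_def assms(3))
  then show ?thesis
    using c(2)[symmetric] by (simp add: w_def)
qed

text \<open>Banach's fixed point theorem for the Picard operator. The iteration takes place in the complete
  space of bounded continuous functions on the whole line; clamping time to \<open>[-e, e]\<close> turns the
  integral into such a function. Since the integration starts at \<open>-e\<close>, the value at \<open>0\<close> is corrected by
  subtracting the integral up to \<open>0\<close>, so the total length of integration is at most \<open>3 e\<close>.\<close>

lemma ode_local_existence:
  fixes F :: "'a::banach \<Rightarrow> 'a"
  assumes "lipschitz_near x F"
  obtains e y where "e > 0" "y 0 = x"
    "\<And>t. \<bar>t\<bar> < e \<Longrightarrow> (y has_vector_derivative F (y t)) (at t)"
proof -
  obtain r0 K where "r0 > 0" and K0: "K-lipschitz_on (ball x r0) F"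
    using assms unfolding lipschitz_near_def by blast
  define r where "r = r0 / 2"
  have r: "r > 0"
    using \<open>r0 > 0\<close> by (simp add: r_def)
  have K: "K-lipschitz_on (cball x r) F"
    by (rule lipschitz_on_subset[OF K0]) (use \<open>r0 > 0\<close> in \<open>auto simp: r_def\<close>)
  have "K \<ge> 0"
    using K by (rule lipschitz_on_nonneg)
  define M where "M = norm (F x) + K * r"
  have "M \<ge> 0"
    using r \<open>K \<ge> 0\<close> by (simp add: M_def)
  have FM: "norm (F y) \<le> M" if "y \<in> cball x r" for y
  proof -
    have "dist (F y) (F x) \<le> K * dist y x"
      by (rule lipschitz_onD[OF K that]) (use r in simp)
    also have "\<dots> \<le> K * r"
      using that \<open>K \<ge> 0\<close> by (intro mult_left_mono) (auto simp: dist_commute)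
    finally show ?thesis
      using norm_triangle_sub[of "F y" "F x"] by (simp add: M_def dist_norm)
  qed
  \<comment> \<open>The first bound makes the Picard operator a contraction by 1/2, the second keeps it in the ball.\<close>
  define e where "e = min (1 / (6 * (K + 1))) (r / (3 * (M + 1)))"
  have e: "e > 0" "3 * e * K \<le> 1 / 2" "3 * e * M \<le> r"
  proof -
    show "e > 0"
      using r \<open>K \<ge> 0\<close> \<open>M \<ge> 0\<close> by (simp add: e_def)
    have "3 * e * K \<le> 3 * (1 / (6 * (K + 1))) * K"
      using \<open>K \<ge> 0\<close> by (intro mult_right_mono mult_left_mono) (auto simp: e_def)
    also have "\<dots> \<le> 1 / 2"
      using \<open>K \<ge> 0\<close> by (simp add: divide_simps)
    finally show "3 * e * K \<le> 1 / 2" .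
    have "3 * e * M \<le> 3 * (r / (3 * (M + 1))) * M"
      using \<open>M \<ge> 0\<close> by (intro mult_right_mono mult_left_mono) (auto simp: e_def)
    also have "\<dots> \<le> r"
      using \<open>M \<ge> 0\<close> r by (simp add: divide_simps mult_left_mono)
    finally show "3 * e * M \<le> r" .
  qed
  define c where "c t = max (- e) (min e t)" for t :: real
  have c: "- e \<le> c t" "c t \<le> e" for t
    using e(1) by (auto simp: c_def)
  have c_cont: "continuous_on UNIV c"
    unfolding c_def by (intro continuous_intros)
  define S :: "(real \<Rightarrow>\<^sub>C 'a) set" where "S = PiC UNIV (\<lambda>_. cball x r)"
  have S: "g \<in> S \<longleftrightarrow> (\<forall>t. apply_bcontfun g t \<in> cball x r)" for g
    by (simp add: S_def mem_PiC_iff Pi_def)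
  have Fcont: "continuous_on {a..b} (\<lambda>s. F (apply_bcontfun g s))" if "g \<in> S" for g a b
    by (rule continuous_on_compose2[OF lipschitz_on_continuous_on[OF K]])
      (use that S continuous_on_subset in auto)
  have Fint: "(\<lambda>s. F (apply_bcontfun g s)) integrable_on {a..b}" if "g \<in> S" for g a b
    by (rule integrable_continuous_real[OF Fcont[OF that]])
  define I where "I g t = integral {- e..t} (\<lambda>s. F (apply_bcontfun g s)) -
      integral {- e..0} (\<lambda>s. F (apply_bcontfun g s))" for g t
  define P where "P g t = x + I g (c t)" for g t
  have Iwidth: "norm (integral {- e..t} f - integral {- e..0} f) \<le> 3 * e * B"
    if f: "\<And>a b. continuous_on {a..b} f" and B: "\<And>s. norm (f s) \<le> B" and t: "- e \<le> t" "t \<le> e"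
    for f :: "real \<Rightarrow> 'a" and B t
  proof -
    have "B \<ge> 0"
      using B[of 0] norm_ge_zero order_trans by blast
    have "norm (integral {- e..t} f) \<le> B * (t - - e)"
      by (rule integral_bound) (use t f B in auto)
    also have "\<dots> \<le> B * (2 * e)"
      using t \<open>B \<ge> 0\<close> by (intro mult_left_mono) auto
    finally have "norm (integral {- e..t} f) \<le> B * (2 * e)" .
    moreover have "norm (integral {- e..0} f) \<le> B * (0 - - e)"
      by (rule integral_bound) (use e f B in auto)
    ultimately show ?thesis
      using norm_triangle_ineq4[of "integral {- e..t} f" "integral {- e..0} f"]
      by (simp add: algebra_simps)
  qed
  have Pball: "P g t \<in> cball x r" if "g \<in> S" for g t
  proof -
    have "norm (I g (c t)) \<le> 3 * e * M"
      unfolding I_def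
    proof (rule Iwidth[OF Fcont[OF that] _ c])
      show "norm (F (apply_bcontfun g s)) \<le> M" for s
        using FM that S by blast
    qed
    then show ?thesis
      using e(3) by (simp add: P_def dist_norm)
  qed
  have Ider: "((\<lambda>t. I g t) has_vector_derivative F (apply_bcontfun g t)) (at t within {- e..e})"
    if "g \<in> S" "t \<in> {- e..e}" for g t
  proof -
    have "((\<lambda>t. integral {- e..t} (\<lambda>s. F (apply_bcontfun g s))) has_vector_derivative
        F (apply_bcontfun g t)) (at t within {- e..e})"
      by (rule integral_has_vector_derivative[OF Fcont[OF that(1)] that(2)])
    then show ?thesis
      unfolding I_def
      using has_vector_derivative_diff[OF _ has_vector_derivative_const
          [of "integral {- e..0} (\<lambda>s. F (apply_bcontfun g s))"]]
      by fastforce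
  qed
  have Pb: "P g \<in> bcontfun" if "g \<in> S" for g
    unfolding bcontfun_def
  proof safe
    have "continuous_on {- e..e} (I g)"
      unfolding continuous_on_eq_continuous_within
      using Ider[OF that] has_vector_derivative_continuous by blast
    then have "continuous_on UNIV (\<lambda>t. I g (c t))"
      by (rule continuous_on_compose2[OF _ c_cont]) (use c in auto)
    then show "continuous_on UNIV (P g)"
      unfolding P_def by (intro continuous_intros)
    show "bounded (range (P g))"
      by (rule bounded_subset[OF bounded_cball]) (use Pball[OF that] in blast)
  qed
  define Q where "Q g = Bcontfun (P g)" for g
  have Q: "apply_bcontfun (Q g) = P g" if "g \<in> S" for g
    unfolding Q_def by (rule Bcontfun_inverse[OF Pb[OF that]])
  have "\<exists>!g. g \<in> S \<and> Q g = g"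
  proof (rule Banach_fix[of S "1 / 2" Q])
    show "complete S"
      unfolding S_def complete_eq_closed by (rule closed_PiC) auto
    have "const_bcontfun x \<in> S"
      using r by (simp add: S const_bcontfun.rep_eq)
    then show "S \<noteq> {}"
      by blast
    show "Q ` S \<subseteq> S"
      using Q Pball by (auto simp: S)
    show "dist (Q g) (Q h) \<le> 1 / 2 * dist g h" if "g \<in> S" "h \<in> S" for g h
    proof (rule dist_bound)
      fix t
      let ?d = "\<lambda>s. F (apply_bcontfun g s) - F (apply_bcontfun h s)"
      have "I g (c t) - I h (c t) = integral {- e..c t} ?d - integral {- e..0} ?d"
        using Fint that by (simp add: I_def integral_diff)
      also have "norm \<dots> \<le> 3 * e * (K * dist g h)"
      proof (rule Iwidth)
        show "continuous_on {a..b} ?d" for a b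
          using Fcont that by (intro continuous_intros)
        show "norm (?d s) \<le> K * dist g h" for s
        proof -
          have "dist (F (apply_bcontfun g s)) (F (apply_bcontfun h s)) \<le>
              K * dist (apply_bcontfun g s) (apply_bcontfun h s)"
            by (rule lipschitz_onD[OF K]) (use that S in auto)
          also have "\<dots> \<le> K * dist g h"
            by (rule mult_left_mono[OF dist_bounded \<open>K \<ge> 0\<close>])
          finally show ?thesis
            by (simp add: dist_norm)
        qed
      qed (use c in auto)
      also have "\<dots> \<le> 1 / 2 * dist g h"
        using mult_right_mono[OF e(2), of "dist g h"] by (simp add: mult_ac)
      finally show "dist (apply_bcontfun (Q g) t) (apply_bcontfun (Q h) t) \<le> 1 / 2 * dist g h"
        using that by (simp add: Q P_def dist_norm)
    qed
  qed auto
  then obtain g where g: "g \<in> S" "Q g = g"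
    by blast
  have gP: "apply_bcontfun g t = x + I g (c t)" for t
    using Q[OF g(1)] g(2) by (metis P_def)
  show thesis
  proof (rule that[of e "apply_bcontfun g"])
    show "apply_bcontfun g 0 = x"
      using e(1) by (subst gP) (simp add: c_def I_def)
    fix t :: real assume t: "\<bar>t\<bar> < e"
    have "t \<in> {- e..e}"
      using t by auto
    then have "((\<lambda>t. x + I g t) has_vector_derivative 0 + F (apply_bcontfun g t)) (at t within {- e..e})"
      by (intro has_vector_derivative_add has_vector_derivative_const Ider g(1))
    moreover have "at t within {- e..e} = at t"
      using t by (intro at_within_interior) auto
    ultimately have "((\<lambda>t. x + I g t) has_vector_derivative F (apply_bcontfun g t)) (at t)"
      by simp
    then show "(apply_bcontfun g has_vector_derivative F (apply_bcontfun g t)) (at t)"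
      by (rule has_vector_derivative_transform_within_open[where S = "{- e<..<e}"])
        (use t gP in \<open>auto simp: c_def\<close>)
  qed (fact e)
qed

section \<open>Alternating forms with a kernel\<close>

lemma permute_list_update:
  assumes "\<sigma> permutes {..<length vs}" "m < length vs"
  shows "permute_list \<sigma> (vs[\<sigma> m := u]) = (permute_list \<sigma> vs)[m := u]"
proof (rule nth_equalityI)
  fix i assume "i < length (permute_list \<sigma> (vs[\<sigma> m := u]))"
  then have i: "i < length vs"
    by simp
  have "\<sigma> i < length vs" "\<sigma> i = \<sigma> m \<longleftrightarrow> i = m"
    using permutes_in_image[OF assms(1)] i permutes_inj[OF assms(1)] by (auto dest: injD)
  then show "permute_list \<sigma> (vs[\<sigma> m := u]) ! i = (permute_list \<sigma> vs)[m := u] ! i"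
    using assms i by (auto simp: permute_list_nth nth_list_update)
qed simp

lemma wedge_linear:
  assumes \<alpha>: "\<And>vs i. length vs = p \<Longrightarrow> i < p \<Longrightarrow> linear (\<lambda>u. \<alpha> (vs[i := u]))"
    and \<beta>: "\<And>vs i. length vs = q \<Longrightarrow> i < q \<Longrightarrow> linear (\<lambda>u. \<beta> (vs[i := u]))"
    and vs: "length vs = p + q" "i < p + q"
  shows "linear (\<lambda>u. wedge p q \<alpha> \<beta> (vs[i := u]))"
proof -
  have summand: "linear (\<lambda>u. of_int (sign \<sigma>) * \<alpha> (take p (permute_list \<sigma> (vs[i := u]))) *
      \<beta> (drop p (permute_list \<sigma> (vs[i := u]))))"
    if "\<sigma> permutes {..<p + q}" for \<sigma>
  proof -
    have \<sigma>: "\<sigma> permutes {..<length vs}"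
      using that vs(1) by simp
    have "i \<in> \<sigma> ` {..<p + q}"
      using permutes_image[OF that] vs(2) by simp
    then obtain m where m: "m < p + q" "\<sigma> m = i"
      by blast
    let ?xs = "permute_list \<sigma> vs"
    have upd: "permute_list \<sigma> (vs[i := u]) = ?xs[m := u]" for u
      using permute_list_update[OF \<sigma>] m vs(1) by auto
    show ?thesis
    proof (cases "m < p")
      case True
      have "linear (\<lambda>u. (of_int (sign \<sigma>) * \<beta> (drop p ?xs)) *\<^sub>R \<alpha> ((take p ?xs)[m := u]))"
        by (intro linear_compose_scale_right \<alpha>) (use vs True in auto)
      then show ?thesis
        by (simp add: upd True take_update_swap mult_ac)
    next
      case False
      have "linear (\<lambda>u. (of_int (sign \<sigma>) * \<alpha> (take p ?xs)) *\<^sub>R \<beta> ((drop p ?xs)[m - p := u]))"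
        by (intro linear_compose_scale_right \<beta>) (use vs False m in auto)
      then show ?thesis
        using False by (simp add: upd drop_update_swap)
    qed
  qed
  have "linear (\<lambda>u. (1 / (fact p * fact q)) *\<^sub>R (\<Sum>\<sigma> | \<sigma> permutes {..<p + q}.
      of_int (sign \<sigma>) * \<alpha> (take p (permute_list \<sigma> (vs[i := u]))) *
      \<beta> (drop p (permute_list \<sigma> (vs[i := u])))))"
    by (rule linear_compose_scale_right[OF linear_compose_sum]) (use summand in auto)
  then show ?thesis
    by (simp add: wedge_def)
qed

text \<open>The sum over permutations changes sign when every \<open>\<sigma>\<close> is replaced by \<open>\<tau> \<circ> \<sigma>\<close> for the transposition \<open>\<tau>\<close>
  of two equal entries, while the values of \<open>\<alpha>\<close> and \<open>\<beta>\<close> do not change.\<close>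

lemma wedge_eq_zero_if_repeated:
  assumes vs: "length vs = p + q" and ij: "i < p + q" "j < p + q" "i \<noteq> j" "vs ! i = vs ! j"
  shows "wedge p q \<alpha> \<beta> vs = 0"
proof -
  let ?P = "{\<sigma>. \<sigma> permutes {..<p + q}}" and ?\<tau> = "Transposition.transpose i j"
  define g where "g xs = \<alpha> (take p xs) * \<beta> (drop p xs)" for xs
  have \<tau>: "?\<tau> permutes {..<p + q}"
    using ij by (intro permutes_swap_id) auto
  have fixed: "permute_list ?\<tau> vs = vs"
  proof (rule nth_equalityI)
    fix k assume "k < length (permute_list ?\<tau> vs)"
    then show "permute_list ?\<tau> vs ! k = vs ! k"
      using \<tau> vs ij by (auto simp: permute_list_nth Transposition.transpose_def)
  qed simp
  have "(\<Sum>\<sigma>\<in>?P. of_int (sign \<sigma>) * g (permute_list \<sigma> vs)) =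
      (\<Sum>\<sigma>\<in>?P. of_int (sign (?\<tau> \<circ> \<sigma>)) * g (permute_list (?\<tau> \<circ> \<sigma>) vs))"
    by (rule setum_permutations_compose_left[OF \<tau>])
  also have "\<dots> = (\<Sum>\<sigma>\<in>?P. - (of_int (sign \<sigma>) * g (permute_list \<sigma> vs)))"
  proof (rule sum.cong)
    fix \<sigma> assume "\<sigma> \<in> ?P"
    then have "\<sigma> permutes {..<p + q}"
      by simp
    then have "sign (?\<tau> \<circ> \<sigma>) = - sign \<sigma>" "permute_list (?\<tau> \<circ> \<sigma>) vs = permute_list \<sigma> vs"
      using ij(3) vs fixed permutes_imp_permutation[of "{..<p + q}"] \<tau>
      by (auto simp: sign_compose sign_swap_id permute_list_compose)
    then show "of_int (sign (?\<tau> \<circ> \<sigma>)) * g (permute_list (?\<tau> \<circ> \<sigma>) vs) =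
        - (of_int (sign \<sigma>) * g (permute_list \<sigma> vs))"
      by simp
  qed simp
  finally have "(\<Sum>\<sigma>\<in>?P. of_int (sign \<sigma>) * g (permute_list \<sigma> vs)) = 0"
    by (simp add: sum_negf)
  then show ?thesis
    by (simp add: wedge_def g_def mult.assoc)
qed

lemma alternating_form_wedge_power:
  assumes "alternating_form 2 \<omega>"
  shows "alternating_form (2 * k) (wedge_power \<omega> k)"
proof (induction k)
  case 0
  then show ?case
    by (simp add: alternating_form_def)
next
  case (Suc k)
  show ?case
    unfolding alternating_form_def
  proof (intro conjI allI impI)
    fix vs :: "'a list" and i
    assume "length vs = 2 * Suc k" "i < 2 * Suc k"
    then show "linear (\<lambda>u. wedge_power \<omega> (Suc k) (vs[i := u]))"
      unfolding wedge_power.simps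
      by (intro wedge_linear) (use assms Suc in \<open>auto simp: alternating_form_def\<close>)
  next
    fix vs :: "'a list" and i j
    assume "length vs = 2 * Suc k" "i < 2 * Suc k" "j < 2 * Suc k" "i \<noteq> j \<and> vs ! i = vs ! j"
    then show "wedge_power \<omega> (Suc k) vs = 0"
      unfolding wedge_power.simps by (intro wedge_eq_zero_if_repeated[of vs 2 "2 * k" i j]) auto
  qed
qed

text \<open>Each summand of the wedge product either inserts \<open>u\<close> into \<open>\<omega>\<close> or leaves it to the lower power.\<close>

lemma wedge_power_eq_zero_if_kernel:
  assumes "length vs = 2 * k" "u \<in> set vs"
    and "\<And>v. v \<in> set vs \<Longrightarrow> \<omega> [u, v] = 0" "\<And>v. v \<in> set vs \<Longrightarrow> \<omega> [v, u] = 0"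
  shows "wedge_power \<omega> k vs = 0"
  using assms
proof (induction k arbitrary: vs)
  case (Suc k)
  have "\<omega> (take 2 (permute_list \<sigma> vs)) * wedge_power \<omega> k (drop 2 (permute_list \<sigma> vs)) = 0"
    if "\<sigma> permutes {..<2 + 2 * k}" for \<sigma>
  proof -
    have len: "length vs = 2 + 2 * k"
      using Suc.prems(1) by simp
    then have set: "set (permute_list \<sigma> vs) = set vs"
      using that by (intro set_permute_list) simp
    obtain a b ys where xs: "permute_list \<sigma> vs = a # b # ys"
      using len by (metis length_permute_list add_2_eq_Suc length_Suc_conv)
    have ab: "set vs = {a, b} \<union> set ys"
      using set xs by auto
    show ?thesis
    proof (cases "u \<in> {a, b}")
      case True
      then have "\<omega> [a, b] = 0"
        using Suc.prems(3,4) ab by auto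
      then show ?thesis
        by (simp add: xs)
    next
      case False
      have "length ys = 2 * k"
        using len xs by (metis length_permute_list length_Cons add_2_eq_Suc nat.inject)
      then have "wedge_power \<omega> k ys = 0"
        using False Suc.prems(2-) ab by (intro Suc.IH) auto
      then show ?thesis
        by (simp add: xs)
    qed
  qed
  then show ?case
    by (simp add: wedge_def mult.assoc sum.neutral)
qed simp

lemma alternating_form_one_linear:
  assumes "alternating_form 1 \<alpha>"
  shows "linear (\<lambda>u. \<alpha> [u])"
  using assms[unfolded alternating_form_def, THEN conjunct1, rule_format, of "[undefined]" 0] by simp

lemma alternating_form_two_linear:
  assumes "alternating_form 2 \<omega>"
  shows "linear (\<lambda>u. \<omega> [u, v])" "linear (\<lambda>v. \<omega> [u, v])"
  using assms[unfolded alternating_form_def, THEN conjunct1, rule_format, of "[u, v]" 0]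
    assms[unfolded alternating_form_def, THEN conjunct1, rule_format, of "[u, v]" 1] by simp_all

lemma alternating_form_two_skew:
  assumes "alternating_form 2 \<omega>"
  shows "\<omega> [v, u] = - \<omega> [u, v]"
proof -
  have zero: "\<omega> [x, x] = 0" for x
    using assms[unfolded alternating_form_def, THEN conjunct2, rule_format, of "[x, x]" 0 1] by simp
  have "\<omega> [u + v, u + v] = \<omega> [u, u] + \<omega> [u, v] + (\<omega> [v, u] + \<omega> [v, v])"
    using alternating_form_two_linear[OF assms, THEN linear_add] by simp
  then show ?thesis
    by (simp add: zero)
qed

text \<open>If \<open>\<alpha> vs \<noteq> 0\<close>, then \<open>vs\<close> is independent, hence a basis of \<open>W\<close>, and \<open>u\<close> has a nonzero coefficient \<open>c\<close> at
  some \<open>v = vs ! i\<close>. Exchanging \<open>v\<close> for \<open>u\<close> multiplies the value by \<open>c\<close> but makes it zero.\<close>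

lemma alternating_form_eq_zero_if_kernel:
  fixes W :: "'e::euclidean_space set"
  assumes alt: "alternating_form n \<alpha>" and W: "subspace W" "dim W = n"
    and u: "u \<in> W" "u \<noteq> 0"
    and ker: "\<And>ws. length ws = n \<Longrightarrow> set ws \<subseteq> W \<Longrightarrow> u \<in> set ws \<Longrightarrow> \<alpha> ws = 0"
    and vs: "length vs = n" "set vs \<subseteq> W"
  shows "\<alpha> vs = 0"
proof (rule ccontr)
  assume nz: "\<alpha> vs \<noteq> 0"
  have lin: "linear (\<lambda>w. \<alpha> (vs[i := w]))" if "i < n" for i
    using alt vs(1) that by (auto simp: alternating_form_def)
  have rep: "\<alpha> ws = 0" if "length ws = n" "i < n" "j < n" "i \<noteq> j" "ws ! i = ws ! j" for ws i j
    using alt that unfolding alternating_form_def by blast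
  have upd: "\<alpha> (vs[i := w]) = 0" if i: "i < n" and w: "w \<in> span (set vs - {vs ! i})" for i w
    using w
  proof (induction rule: span_induct_alt)
    case base
    then show ?case
      using linear_0[OF lin[OF i]] by simp
  next
    case (step c x y)
    obtain j where j: "j < n" "x = vs ! j" "j \<noteq> i"
      using step.hyps vs(1) by (auto simp: in_set_conv_nth)
    have "\<alpha> (vs[i := x]) = 0"
      by (rule rep[of _ i j]) (use i j vs(1) in \<open>auto simp: nth_list_update\<close>)
    then show ?case
      using step.IH linear_add[OF lin[OF i]] linear_scale[OF lin[OF i]] by simp
  qed
  have "distinct vs"
    using rep[OF vs(1)] nz vs(1) by (auto simp: distinct_conv_nth)
  then have card: "card (set vs) = n"
    using vs(1) by (simp add: distinct_card)
  have indep: "independent (set vs)"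
  proof
    assume "dependent (set vs)"
    then obtain i where "i < n" "vs ! i \<in> span (set vs - {vs ! i})"
      using vs(1) by (auto simp: dependent_def in_set_conv_nth)
    then show False
      using upd[of i "vs ! i"] nz by simp
  qed
  have "W \<subseteq> span (set vs)"
    using card_eq_dim[OF vs(2)] indep card W(2) by simp
  then obtain c where c: "u = (\<Sum>v\<in>set vs. c v *\<^sub>R v)"
    using u(1) by (subst (asm) span_finite) auto
  obtain v where v: "v \<in> set vs" "c v \<noteq> 0"
    using u(2) c by (metis (no_types, lifting) scale_eq_0_iff sum.neutral)
  obtain i where i: "i < n" "vs ! i = v"
    using v(1) vs(1) by (auto simp: in_set_conv_nth)
  have "u - c v *\<^sub>R v = (\<Sum>w\<in>set vs - {v}. c w *\<^sub>R w)"
    using v(1) by (simp add: c sum.remove)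
  then have "u - c v *\<^sub>R v \<in> span (set vs - {vs ! i})"
    using i(2) by (simp only:) (intro span_sum span_scale span_base, simp)
  then have "\<alpha> (vs[i := u - c v *\<^sub>R v]) = 0"
    using upd i(1) by blast
  then have "\<alpha> (vs[i := u]) = c v * \<alpha> vs"
    using linear_diff[OF lin[OF i(1)]] linear_scale[OF lin[OF i(1)]] i(2) by auto
  moreover have "\<alpha> (vs[i := u]) = 0"
    by (rule ker) (use vs u(1) i set_update_subset_insert[of vs i u] set_update_memI[of i vs u] in auto)
  ultimately show False
    using v(2) nz by simp
qed

section \<open>Coordinate changes and vector fields\<close>

lemma cinv_cmap: "is_chart c \<Longrightarrow> x \<in> cdom c \<Longrightarrow> cinv c (cmap c x) = x"
  by (auto simp: is_chart_def homeomorphism_def)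

lemma cmap_cinv: "is_chart c \<Longrightarrow> y \<in> cmap c ` cdom c \<Longrightarrow> cmap c (cinv c y) = y"
  by (auto simp: is_chart_def homeomorphism_def)

lemma cinv_in_cdom: "is_chart c \<Longrightarrow> y \<in> cmap c ` cdom c \<Longrightarrow> cinv c y \<in> cdom c"
  by (auto simp: cinv_cmap)

lemma open_chart_image:
  assumes "is_chart c" "open U"
  shows "open (cmap c ` (cdom c \<inter> U))"
proof -
  have "openin (top_of_set (cmap c ` cdom c)) (cmap c ` (cdom c \<inter> U))"
    using assms openin_open_Int unfolding is_chart_def
    by (intro homeomorphism_imp_open_map[of "cdom c" _ _ "cinv c"]) auto
  moreover have "open (cmap c ` cdom c)"
    using assms(1) by (simp add: is_chart_def)
  ultimately show ?thesis
    by (meson openin_open_eq)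
qed

lemma isCont_real_neighbourhood:
  fixes f :: "real \<Rightarrow> 'a::topological_space"
  assumes "isCont f t" "open U" "f t \<in> U"
  obtains e where "e > 0" "\<And>s. \<bar>s - t\<bar> < e \<Longrightarrow> f s \<in> U"
proof -
  have "filterlim f (nhds (f t)) (nhds t)"
    using assms(1) by (simp add: isCont_def tendsto_at_iff_tendsto_nhds)
  then have "eventually (\<lambda>s. f s \<in> U) (nhds t)"
    using assms(2,3) topological_tendstoD by blast
  then show thesis
    using that by (auto simp: eventually_nhds_metric dist_real_def)
qed

text \<open>Two charts related in this way may be a chart of the atlas and a slice chart of a submanifold,
  which belongs only to the maximal atlas.\<close>

definition compatible ::
  "('m::topological_space, 'e::euclidean_space) chart \<Rightarrow> ('m, 'e) chart \<Rightarrow> bool" where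
  "compatible c c' \<longleftrightarrow>
     is_chart c \<and> is_chart c' \<and> smooth_transition c c' \<and> smooth_transition c' c"

lemma compatible_sym: "compatible c c' \<Longrightarrow> compatible c' c"
  by (simp add: compatible_def)

lemma compatible_charts: "compatible c c' \<Longrightarrow> is_chart c" "compatible c c' \<Longrightarrow> is_chart c'"
  by (simp_all add: compatible_def)

definition transition_deriv ::
  "('m, 'e::euclidean_space) chart \<Rightarrow> ('m, 'e) chart \<Rightarrow> 'm \<Rightarrow> 'e \<Rightarrow> 'e" where
  "transition_deriv c c' x = frechet_derivative (cmap c' \<circ> cinv c) (at (cmap c x))"

lemma tangent_transition_eq_transition_deriv: "tangent_transition A c x = transition_deriv c (chart_at A x) x"
  by (simp add: tangent_transition_def transition_deriv_def)

context
  fixes c c' :: "('m::topological_space, 'e::euclidean_space) chart"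
  assumes cc': "compatible c c'"
begin

lemma open_overlap: "open (cmap c ` (cdom c \<inter> cdom c'))"
  using cc' by (intro open_chart_image) (auto simp: compatible_def is_chart_def)

lemma smooth_on_overlap: "smooth_on (cmap c ` (cdom c \<inter> cdom c')) (cmap c' \<circ> cinv c)"
  using cc' by (simp add: compatible_def smooth_transition_def)

lemma has_derivative_transition_deriv:
  assumes "x \<in> cdom c" "x \<in> cdom c'"
  shows "((cmap c' \<circ> cinv c) has_derivative transition_deriv c c' x) (at (cmap c x))"
  unfolding transition_deriv_def frechet_derivative_works[symmetric]
  by (rule smooth_on_differentiable[OF smooth_on_overlap]) (use assms in auto)

lemma linear_transition_deriv: "x \<in> cdom c \<Longrightarrow> x \<in> cdom c' \<Longrightarrow> linear (transition_deriv c c' x)"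
  using has_derivative_transition_deriv has_derivative_linear by blast

lemma lipschitz_near_transition:
  assumes "x \<in> cdom c" "x \<in> cdom c'"
  shows "lipschitz_near (cmap c x) (\<lambda>y. cmap c' (cinv c y))"
  using smooth_on_imp_lipschitz_near[OF smooth_on_overlap open_overlap] assms by (auto simp: comp_def)

lemma lipschitz_near_transition_deriv:
  assumes "x \<in> cdom c" "x \<in> cdom c'"
  shows "lipschitz_near (cmap c x) (\<lambda>y. transition_deriv c c' (cinv c y) v)"
proof (rule lipschitz_near_transform[OF _ open_overlap])
  show "lipschitz_near (cmap c x) (\<lambda>y. frechet_derivative (cmap c' \<circ> cinv c) (at y) v)"
    using assms by (intro smooth_on_imp_lipschitz_near[OF smooth_on_derivative[OF smooth_on_overlap] open_overlap]) auto
  show "frechet_derivative (cmap c' \<circ> cinv c) (at y) v = transition_deriv c c' (cinv c y) v"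
    if "y \<in> cmap c ` (cdom c \<inter> cdom c')" for y
  proof -
    have "cmap c (cinv c y) = y"
      using that compatible_charts(1)[OF cc'] by (intro cmap_cinv) auto
    then show ?thesis
      by (simp add: transition_deriv_def)
  qed
qed (use assms in auto)

text \<open>A function that reads \<open>f\<close> in the chart \<open>c'\<close> and \<open>g\<close> in the chart \<open>c\<close> transforms by the chain rule. The
  rules for inverting and composing coordinate changes are instances of it.\<close>

lemma has_derivative_transition_deriv_chain:
  assumes f: "(f has_derivative f') (at (cmap c' x))"
    and fg: "\<And>z. z \<in> cdom c \<Longrightarrow> z \<in> cdom c' \<Longrightarrow> f (cmap c' z) = g (cmap c z)"
    and x: "x \<in> cdom c" "x \<in> cdom c'"
  shows "(g has_derivative (\<lambda>v. f' (transition_deriv c c' x v))) (at (cmap c x))"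
proof -
  have inv: "cinv c (cmap c z) = z" if "z \<in> cdom c" for z
    using cinv_cmap[OF compatible_charts(1)[OF cc'] that] .
  have "(f \<circ> (cmap c' \<circ> cinv c) has_derivative f' \<circ> transition_deriv c c' x) (at (cmap c x))"
    by (rule diff_chain_at[OF has_derivative_transition_deriv[OF x]]) (use f inv x in simp)
  then have "(g has_derivative f' \<circ> transition_deriv c c' x) (at (cmap c x))"
    by (rule has_derivative_transform_within_open[OF _ open_overlap]) (use x inv fg in auto)
  then show ?thesis
    by (simp add: comp_def)
qed

lemma transition_deriv_inverse:
  assumes x: "x \<in> cdom c" "x \<in> cdom c'"
  shows "transition_deriv c' c x (transition_deriv c c' x v) = v"
proof -
  have "((\<lambda>y. y) has_derivative (\<lambda>v. transition_deriv c' c x (transition_deriv c c' x v))) (at (cmap c x))"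
  proof (rule has_derivative_transition_deriv_chain[OF _ _ x])
    have "smooth_transition c' c"
      using cc' by (simp add: compatible_def)
    then have "(cmap c \<circ> cinv c') differentiable (at (cmap c' x))"
      unfolding smooth_transition_def by (rule smooth_on_differentiable) (use x in auto)
    then show "((cmap c \<circ> cinv c') has_derivative transition_deriv c' c x) (at (cmap c' x))"
      by (simp add: transition_deriv_def frechet_derivative_works)
    show "(cmap c \<circ> cinv c') (cmap c' z) = cmap c z" if "z \<in> cdom c'" for z
      using cinv_cmap[OF compatible_charts(2)[OF cc'] that] by simp
  qed
  then have "(\<lambda>v. transition_deriv c' c x (transition_deriv c c' x v)) = (\<lambda>v. v)"
    by (rule has_derivative_unique) (rule has_derivative_ident)
  then show ?thesis
    by metis
qed

lemma curve_velocity_transition: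
  assumes \<gamma>: "isCont \<gamma> t" "\<gamma> t \<in> cdom c" "\<gamma> t \<in> cdom c'"
    and v: "((\<lambda>s. cmap c (\<gamma> s)) has_vector_derivative v) (at t)"
  shows "((\<lambda>s. cmap c' (\<gamma> s)) has_vector_derivative transition_deriv c c' (\<gamma> t) v) (at t)"
proof -
  have "open (cdom c \<inter> cdom c')"
    using cc' by (auto simp: compatible_def is_chart_def)
  then obtain e where e: "e > 0" "\<And>s. \<bar>s - t\<bar> < e \<Longrightarrow> \<gamma> s \<in> cdom c \<inter> cdom c'"
    using isCont_real_neighbourhood[OF \<gamma>(1)] \<gamma>(2,3) by blast
  have lin: "linear (transition_deriv c c' (\<gamma> t))"
    using linear_transition_deriv \<gamma> by blast
  have "((cmap c' \<circ> cinv c) \<circ> (\<lambda>s. cmap c (\<gamma> s)) has_derivative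
      transition_deriv c c' (\<gamma> t) \<circ> (\<lambda>s. s *\<^sub>R v)) (at t)"
    using v has_derivative_transition_deriv[OF \<gamma>(2,3)] unfolding has_vector_derivative_def
    by (intro diff_chain_at) auto
  then have "((cmap c' \<circ> cinv c) \<circ> (\<lambda>s. cmap c (\<gamma> s)) has_vector_derivative transition_deriv c c' (\<gamma> t) v) (at t)"
    by (simp add: has_vector_derivative_def comp_def linear_scale[OF lin])
  then show ?thesis
  proof (rule has_vector_derivative_transform_within_open)
    show "open (ball t e)" "t \<in> ball t e"
      using e(1) by auto
    show "((cmap c' \<circ> cinv c) \<circ> (\<lambda>s. cmap c (\<gamma> s))) s = cmap c' (\<gamma> s)" if "s \<in> ball t e" for s
      using e(2)[of s] that cinv_cmap[OF compatible_charts(1)[OF cc']]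
      by (simp add: dist_real_def abs_minus_commute)
  qed
qed

end

lemma transition_deriv_compose:
  assumes "compatible c c'" "compatible c' c''" "x \<in> cdom c" "x \<in> cdom c'" "x \<in> cdom c''"
  shows "transition_deriv c c'' x v = transition_deriv c' c'' x (transition_deriv c c' x v)"
proof -
  have "((cmap c'' \<circ> cinv c) has_derivative (\<lambda>v. transition_deriv c' c'' x (transition_deriv c c' x v))) (at (cmap c x))"
  proof (rule has_derivative_transition_deriv_chain[OF assms(1) has_derivative_transition_deriv[OF assms(2,4,5)] _ assms(3,4)])
    show "(cmap c'' \<circ> cinv c') (cmap c' z) = (cmap c'' \<circ> cinv c) (cmap c z)"
      if "z \<in> cdom c" "z \<in> cdom c'" for z
      using that assms(1) by (simp add: cinv_cmap compatible_def)
  qed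
  then show ?thesis
    unfolding transition_deriv_def using frechet_derivative_at by metis
qed

text \<open>The vector \<open>X x\<close> is given in coordinates of the chart chosen at \<open>x\<close>, which varies arbitrarily with \<open>x\<close>;
  only its expression in a fixed chart can be expected to be regular.\<close>

definition vf_in_chart ::
  "('m, 'e::euclidean_space) chart set \<Rightarrow> ('m \<Rightarrow> 'e) \<Rightarrow> ('m, 'e) chart \<Rightarrow> 'e \<Rightarrow> 'e" where
  "vf_in_chart A X c y = transition_deriv (chart_at A (cinv c y)) c (cinv c y) (X (cinv c y))"

locale smooth_manifold =
  fixes A :: "('m::{t2_space, second_countable_topology}, 'e::euclidean_space) chart set"
  assumes atlas: "smooth_atlas A"
begin

lemma compatible_atlas:
  assumes "c \<in> maximal_atlas A" "c' \<in> A"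
  shows "compatible c c'"
  using assms atlas by (simp add: compatible_def maximal_atlas_def smooth_atlas_def)

lemma atlas_subset_maximal: "c \<in> A \<Longrightarrow> c \<in> maximal_atlas A"
  using atlas by (simp add: maximal_atlas_def smooth_atlas_def)

lemma chart_at_in_atlas: "chart_at A x \<in> A" and in_cdom_chart_at: "x \<in> cdom (chart_at A x)"
proof -
  have "x \<in> (\<Union>c\<in>A. cdom c)"
    using atlas by (simp add: smooth_atlas_def)
  then have "\<exists>c. c \<in> A \<and> x \<in> cdom c"
    by blast
  then have "chart_at A x \<in> A \<and> x \<in> cdom (chart_at A x)"
    unfolding chart_at_def by (rule someI_ex)
  then show "chart_at A x \<in> A" "x \<in> cdom (chart_at A x)"
    by auto
qed

lemma maximal_is_chart: "c \<in> maximal_atlas A \<Longrightarrow> is_chart c"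
  by (simp add: maximal_atlas_def)

lemma compatible_chart_at: "c \<in> maximal_atlas A \<Longrightarrow> compatible c (chart_at A x)"
  by (rule compatible_atlas[OF _ chart_at_in_atlas])

lemma linear_tangent_transition:
  "c \<in> maximal_atlas A \<Longrightarrow> x \<in> cdom c \<Longrightarrow> linear (tangent_transition A c x)"
  unfolding tangent_transition_eq_transition_deriv
  by (rule linear_transition_deriv[OF compatible_chart_at _ in_cdom_chart_at])

lemma tangent_transition_vf_in_chart:
  assumes "c \<in> maximal_atlas A" "x \<in> cdom c"
  shows "tangent_transition A c x (vf_in_chart A X c (cmap c x)) = X x"
  using assms transition_deriv_inverse[OF compatible_sym[OF compatible_chart_at] in_cdom_chart_at]
  by (simp add: tangent_transition_eq_transition_deriv vf_in_chart_def cinv_cmap maximal_is_chart)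

lemma vf_in_chart_transition:
  assumes "c \<in> maximal_atlas A" "c' \<in> A" "x \<in> cdom c" "x \<in> cdom c'"
  shows "vf_in_chart A X c (cmap c x) = transition_deriv c' c x (vf_in_chart A X c' (cmap c' x))"
proof -
  have "transition_deriv (chart_at A x) c x (X x) = transition_deriv c' c x (transition_deriv (chart_at A x) c' x (X x))"
  proof (rule transition_deriv_compose)
    show "compatible (chart_at A x) c'"
      using assms(2) compatible_atlas[OF atlas_subset_maximal[OF chart_at_in_atlas]] by blast
    show "compatible c' c"
      using assms(1,2) compatible_atlas compatible_sym by blast
  qed (use assms in_cdom_chart_at in auto)
  then show ?thesis
    using assms by (simp add: vf_in_chart_def cinv_cmap maximal_is_chart atlas_subset_maximal)
qed

definition lipschitz_vf :: "('m \<Rightarrow> 'e) \<Rightarrow> bool" where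
  "lipschitz_vf X \<longleftrightarrow> (\<forall>c\<in>A. \<forall>x\<in>cdom c. lipschitz_near (cmap c x) (vf_in_chart A X c))"

text \<open>Near a point, the expression in \<open>c\<close> is the image of the expression in a chart of the atlas under the
  derivative of the coordinate change, and both depend on the point in a Lipschitz way. This
  makes slice charts available.\<close>

lemma lipschitz_vf_maximal:
  assumes X: "lipschitz_vf X" and c: "c \<in> maximal_atlas A" "x \<in> cdom c"
  shows "lipschitz_near (cmap c x) (vf_in_chart A X c)"
proof -
  define c' where "c' = chart_at A x"
  have c': "c' \<in> A" "x \<in> cdom c'"
    by (auto simp: c'_def chart_at_in_atlas in_cdom_chart_at)
  have cc': "compatible c c'"
    using compatible_atlas c(1) c'(1) .
  have ch: "is_chart c" "is_chart c'"
    using compatible_charts[OF cc'] .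
  let ?\<tau> = "\<lambda>y. cmap c' (cinv c y)"
  have \<tau>: "lipschitz_near (cmap c x) ?\<tau>" "?\<tau> (cmap c x) = cmap c' x"
    using lipschitz_near_transition[OF cc' c(2) c'(2)] cinv_cmap[OF ch(1) c(2)] by auto
  have 1: "lipschitz_near (cmap c x) (\<lambda>y. vf_in_chart A X c' (?\<tau> y))"
    by (rule lipschitz_near_compose[OF \<tau>(1)]) (use X c' \<tau>(2) in \<open>simp add: lipschitz_vf_def\<close>)
  have 2: "lipschitz_near (cmap c x) (\<lambda>y. transition_deriv c' c (cinv c' (?\<tau> y)) b)" for b
    by (rule lipschitz_near_compose[OF \<tau>(1), of "\<lambda>z. transition_deriv c' c (cinv c' z) b"])
      (simp only: \<tau>(2) lipschitz_near_transition_deriv[OF compatible_sym[OF cc'] c'(2) c(2)])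
  have 3: "cinv c y \<in> cdom c" "cinv c y \<in> cdom c'" "cmap c (cinv c y) = y" "cinv c' (?\<tau> y) = cinv c y"
    if y: "y \<in> cmap c ` (cdom c \<inter> cdom c')" for y
  proof -
    obtain z where z: "y = cmap c z" "z \<in> cdom c" "z \<in> cdom c'"
      using y by blast
    then show "cinv c y \<in> cdom c" "cinv c y \<in> cdom c'" "cmap c (cinv c y) = y" "cinv c' (?\<tau> y) = cinv c y"
      by (simp_all add: cinv_cmap[OF ch(1)] cinv_cmap[OF ch(2)])
  qed
  show ?thesis
  proof (rule lipschitz_near_transform[OF _ open_overlap[OF cc']])
    show "lipschitz_near (cmap c x) (\<lambda>y. transition_deriv c' c (cinv c' (?\<tau> y)) (vf_in_chart A X c' (?\<tau> y)))"
    proof (rule lipschitz_near_componentwise[OF _ open_overlap[OF cc'] _ 2 1])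
      show "linear (transition_deriv c' c (cinv c' (?\<tau> y)))" if "y \<in> cmap c ` (cdom c \<inter> cdom c')" for y
        using linear_transition_deriv[OF compatible_sym[OF cc']] 3[OF that] by simp
    qed (use c c' in auto)
    show "transition_deriv c' c (cinv c' (?\<tau> y)) (vf_in_chart A X c' (?\<tau> y)) = vf_in_chart A X c y"
      if "y \<in> cmap c ` (cdom c \<inter> cdom c')" for y
      using vf_in_chart_transition[OF c(1) c'(1), of "cinv c y" X] 3[OF that] by simp
  qed (use c c' in auto)
qed

end

section \<open>Integral curves\<close>

lemma open_real_if_neighbourhoods:
  fixes S :: "real set"
  assumes "\<And>t. t \<in> S \<Longrightarrow> \<exists>e>0. \<forall>s. \<bar>s - t\<bar> < e \<longrightarrow> s \<in> S"
  shows "open S"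
  using assms by (simp add: open_dist dist_real_def)

lemma subspace_projection:
  fixes V :: "'a::real_vector set"
  assumes "subspace V"
  obtains P where "linear P" "\<And>v. P v \<in> V" "\<And>v. v \<in> V \<Longrightarrow> P v = v"
proof -
  obtain P :: "'a \<Rightarrow> 'a" where P: "range P \<subseteq> V" "linear P" "\<forall>v\<in>V. P (id v) = v"
    using linear_exists_left_inverse_on[OF linear_id assms inj_on_id] by blast
  show thesis
    by (rule that[of P]) (use P in auto)
qed

lemma has_vector_derivative_linear:
  fixes P :: "'a::euclidean_space \<Rightarrow> 'b::real_normed_vector"
  assumes "linear P" "(f has_vector_derivative v) (at t)"
  shows "((\<lambda>s. P (f s)) has_vector_derivative P v) (at t)"
  using bounded_linear.has_vector_derivative[OF _ assms(2)] assms(1)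
  by (simp add: linear_conv_bounded_linear)

text \<open>A projection onto \<open>V\<close> fixes the curve, hence also its velocity.\<close>

lemma velocity_in_subspace:
  fixes V :: "'a::euclidean_space set"
  assumes V: "subspace V" and f: "(f has_vector_derivative v) (at t)"
    and e: "e > 0" "\<And>s. \<bar>s - t\<bar> < e \<Longrightarrow> f s \<in> V"
  shows "v \<in> V"
proof -
  obtain P where P: "linear P" "\<And>v. P v \<in> V" "\<And>v. v \<in> V \<Longrightarrow> P v = v"
    using subspace_projection[OF V] by blast
  have "((\<lambda>s. P (f s)) has_vector_derivative P v) (at t)"
    by (rule has_vector_derivative_linear[OF P(1) f])
  then have "(f has_vector_derivative P v) (at t)"
    by (rule has_vector_derivative_transform_within_open[of _ _ _ "ball t e"])
      (use e P(3) in \<open>auto simp: dist_real_def abs_minus_commute\<close>)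
  then have "P v = v"
    using f vector_derivative_unique_at by blast
  then show ?thesis
    using P(2) by metis
qed

context smooth_manifold
begin

lemma integral_curve_isCont: "integral_curve A X J \<gamma> \<Longrightarrow> t \<in> J \<Longrightarrow> isCont \<gamma> t"
  by (auto simp: integral_curve_def continuous_on_eq_continuous_at)

lemma integral_curve_in_chart:
  assumes "integral_curve A X J \<gamma>" "t \<in> J" "c \<in> maximal_atlas A" "\<gamma> t \<in> cdom c"
  shows "((\<lambda>s. cmap c (\<gamma> s)) has_vector_derivative vf_in_chart A X c (cmap c (\<gamma> t))) (at t)"
proof -
  have "((\<lambda>s. cmap (chart_at A (\<gamma> t)) (\<gamma> s)) has_vector_derivative X (\<gamma> t)) (at t)"
    using assms(1,2) by (simp add: integral_curve_def)
  then have "((\<lambda>s. cmap c (\<gamma> s)) has_vector_derivative transition_deriv (chart_at A (\<gamma> t)) c (\<gamma> t) (X (\<gamma> t))) (at t)"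
    by (rule curve_velocity_transition[OF compatible_sym[OF compatible_chart_at[OF assms(3)]]
          integral_curve_isCont[OF assms(1,2)] in_cdom_chart_at assms(4)])
  then show ?thesis
    using assms by (simp add: vf_in_chart_def cinv_cmap maximal_is_chart)
qed

text \<open>A solution of the equation in one chart is an integral curve for all times at which it stays in the
  image of the chart.\<close>

lemma integral_curve_exists:
  assumes X: "lipschitz_vf X"
  obtains e \<gamma> where "e > 0" "integral_curve A X {- e<..<e} \<gamma>" "\<gamma> 0 = x"
proof -
  define c where "c = chart_at A x"
  have c: "c \<in> A" "x \<in> cdom c"
    by (auto simp: c_def chart_at_in_atlas in_cdom_chart_at)
  have cm: "c \<in> maximal_atlas A"
    using c(1) by (rule atlas_subset_maximal)
  have ch: "is_chart c"
    using cm by (rule maximal_is_chart)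
  have "lipschitz_near (cmap c x) (vf_in_chart A X c)"
    using X c by (simp add: lipschitz_vf_def)
  then obtain e1 y where e1: "e1 > 0" and y0: "y 0 = cmap c x"
    and y: "\<And>t. \<bar>t\<bar> < e1 \<Longrightarrow> (y has_vector_derivative vf_in_chart A X c (y t)) (at t)"
    using ode_local_existence by blast
  have y_cont: "isCont y t" if "\<bar>t\<bar> < e1" for t
    using y[OF that] by (rule has_vector_derivative_continuous)
  have "open (cmap c ` cdom c)"
    using ch by (simp add: is_chart_def)
  then obtain e2 where e2: "e2 > 0" "\<And>s. \<bar>s - 0\<bar> < e2 \<Longrightarrow> y s \<in> cmap c ` cdom c"
    using isCont_real_neighbourhood[OF y_cont[of 0], of "cmap c ` cdom c"] e1 y0 c(2) by auto
  define e where "e = min e1 e2"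
  have e: "e > 0"
    using e1 e2(1) by (simp add: e_def)
  have yim: "y s \<in> cmap c ` cdom c" if "s \<in> {- e<..<e}" for s
    using that e2(2)[of s] by (auto simp: e_def)
  define \<gamma> where "\<gamma> s = cinv c (y s)" for s
  have \<gamma>: "\<gamma> s \<in> cdom c" "cmap c (\<gamma> s) = y s" if "s \<in> {- e<..<e}" for s
    using cinv_in_cdom[OF ch yim[OF that]] cmap_cinv[OF ch yim[OF that]] by (simp_all add: \<gamma>_def)
  have "continuous_on (cmap c ` cdom c) (cinv c)"
    using ch by (simp add: is_chart_def homeomorphism_def)
  moreover have "continuous_on {- e<..<e} y"
    using y_cont by (intro continuous_at_imp_continuous_on) (auto simp: e_def)
  ultimately have \<gamma>_cont: "continuous_on {- e<..<e} \<gamma>"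
    unfolding \<gamma>_def by (rule continuous_on_compose2) (use yim in auto)
  have "((\<lambda>s. cmap (chart_at A (\<gamma> t)) (\<gamma> s)) has_vector_derivative X (\<gamma> t)) (at t)"
    if t: "t \<in> {- e<..<e}" for t
  proof -
    have "(y has_vector_derivative vf_in_chart A X c (cmap c (\<gamma> t))) (at t)"
      unfolding \<gamma>(2)[OF t] by (rule y) (use t in \<open>auto simp: e_def\<close>)
    then have "((\<lambda>s. cmap c (\<gamma> s)) has_vector_derivative vf_in_chart A X c (cmap c (\<gamma> t))) (at t)"
      by (rule has_vector_derivative_transform_within_open[of _ _ _ "{- e<..<e}"]) (use t \<gamma>(2) in auto)
    moreover have "isCont \<gamma> t"
      using \<gamma>_cont t by (simp add: continuous_on_eq_continuous_at)
    ultimately have "((\<lambda>s. cmap (chart_at A (\<gamma> t)) (\<gamma> s)) has_vector_derivative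
        transition_deriv c (chart_at A (\<gamma> t)) (\<gamma> t) (vf_in_chart A X c (cmap c (\<gamma> t)))) (at t)"
      by (intro curve_velocity_transition[OF compatible_chart_at[OF cm]] \<gamma>(1) t in_cdom_chart_at)
    then show ?thesis
      using tangent_transition_vf_in_chart[OF cm \<gamma>(1)[OF t]] by (simp add: tangent_transition_eq_transition_deriv)
  qed
  then have "integral_curve A X {- e<..<e} \<gamma>"
    using \<gamma>_cont by (simp add: integral_curve_def is_interval_oo)
  moreover have "\<gamma> 0 = x"
    using y0 cinv_cmap[OF ch c(2)] by (simp add: \<gamma>_def)
  ultimately show thesis
    using that e by blast
qed

text \<open>The difference of the two curves in a common chart satisfies \<open>|z'| \<le> K |z|\<close>.\<close>

lemma integral_curve_unique_near:
  assumes X: "lipschitz_vf X"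
    and 1: "integral_curve A X J1 \<gamma>1" "t \<in> J1" and 2: "integral_curve A X J2 \<gamma>2" "t \<in> J2"
    and eq: "\<gamma>1 t = \<gamma>2 t"
  shows "\<exists>e>0. \<forall>s. \<bar>s - t\<bar> < e \<longrightarrow> s \<in> J1 \<inter> J2 \<and> \<gamma>1 s = \<gamma>2 s"
proof -
  define c where "c = chart_at A (\<gamma>1 t)"
  have c: "c \<in> A" "\<gamma>1 t \<in> cdom c" and cm: "c \<in> maximal_atlas A" and ch: "is_chart c"
    by (auto simp: c_def chart_at_in_atlas in_cdom_chart_at intro!: atlas_subset_maximal maximal_is_chart)
  have "lipschitz_near (cmap c (\<gamma>1 t)) (vf_in_chart A X c)"
    using X c by (simp add: lipschitz_vf_def)
  then obtain r K where r: "r > 0" and K: "K-lipschitz_on (ball (cmap c (\<gamma>1 t)) r) (vf_in_chart A X c)"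
    unfolding lipschitz_near_def by blast
  define U where "U = {z \<in> cdom c. cmap c z \<in> ball (cmap c (\<gamma>1 t)) r}"
  have "open (cdom c \<inter> cmap c -` ball (cmap c (\<gamma>1 t)) r)"
    using ch by (intro continuous_open_preimage) (auto simp: is_chart_def homeomorphism_def)
  then have U: "open U" "\<gamma>1 t \<in> U" "\<gamma>2 t \<in> U"
    using c r eq by (auto simp: U_def vimage_def Int_def)
  have "open (J1 \<inter> J2)"
    using 1 2 by (auto simp: integral_curve_def)
  then obtain e0 where e0: "e0 > 0" "ball t e0 \<subseteq> J1 \<inter> J2"
    using 1 2 openE by blast
  obtain e1 where e1: "e1 > 0" "\<And>s. \<bar>s - t\<bar> < e1 \<Longrightarrow> \<gamma>1 s \<in> U"
    using isCont_real_neighbourhood[OF integral_curve_isCont[OF 1] U(1,2)] by blast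
  obtain e2 where e2: "e2 > 0" "\<And>s. \<bar>s - t\<bar> < e2 \<Longrightarrow> \<gamma>2 s \<in> U"
    using isCont_real_neighbourhood[OF integral_curve_isCont[OF 2] U(1,3)] by blast
  define e where "e = min e0 (min e1 e2)"
  have J: "s \<in> J1" "s \<in> J2" and in_U: "\<gamma>1 s \<in> U" "\<gamma>2 s \<in> U" if "\<bar>s - t\<bar> < e" for s
    using that e0 e1(2)[of s] e2(2)[of s] by (auto simp: e_def dist_real_def abs_minus_commute subset_iff)
  let ?F = "vf_in_chart A X c"
  have zero: "cmap c (\<gamma>1 s) - cmap c (\<gamma>2 s) = 0" if s: "\<bar>s - t\<bar> < e" for s
  proof (rule ode_zero_unique[where z = "\<lambda>s. cmap c (\<gamma>1 s) - cmap c (\<gamma>2 s)" and a = t and e = e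
        and z' = "\<lambda>s. ?F (cmap c (\<gamma>1 s)) - ?F (cmap c (\<gamma>2 s))" and K = K, OF _ _ _ s])
    fix s assume s: "\<bar>s - t\<bar> < e"
    show "((\<lambda>s. cmap c (\<gamma>1 s) - cmap c (\<gamma>2 s)) has_vector_derivative
        ?F (cmap c (\<gamma>1 s)) - ?F (cmap c (\<gamma>2 s))) (at s)"
      using in_U[OF s] J[OF s] unfolding U_def
      by (intro has_vector_derivative_diff integral_curve_in_chart[OF 1(1) _ cm]
          integral_curve_in_chart[OF 2(1) _ cm]) auto
    show "norm (?F (cmap c (\<gamma>1 s)) - ?F (cmap c (\<gamma>2 s))) \<le> K * norm (cmap c (\<gamma>1 s) - cmap c (\<gamma>2 s))"
      using lipschitz_onD[OF K, of "cmap c (\<gamma>1 s)" "cmap c (\<gamma>2 s)"] in_U[OF s]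
      unfolding U_def dist_norm by blast
  qed (simp add: eq)
  have "s \<in> J1 \<inter> J2 \<and> \<gamma>1 s = \<gamma>2 s" if s: "\<bar>s - t\<bar> < e" for s
  proof -
    have "cinv c (cmap c (\<gamma>1 s)) = cinv c (cmap c (\<gamma>2 s))"
      using zero[OF s] by simp
    then have "\<gamma>1 s = \<gamma>2 s"
      using in_U[OF s] cinv_cmap[OF ch] by (simp add: U_def)
    then show ?thesis
      using J[OF s] by simp
  qed
  moreover have "e > 0"
    using e0(1) e1(1) e2(1) by (simp add: e_def)
  ultimately show ?thesis
    by blast
qed

text \<open>On the common interval of definition the times of agreement form an open set by local uniqueness,
  and the times of disagreement form an open set because the manifold is Hausdorff.\<close>

lemma integral_curve_unique:
  assumes X: "lipschitz_vf X"
    and 1: "integral_curve A X J1 \<gamma>1" "0 \<in> J1" "t \<in> J1"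
    and 2: "integral_curve A X J2 \<gamma>2" "0 \<in> J2" "t \<in> J2"
    and eq: "\<gamma>1 0 = \<gamma>2 0"
  shows "\<gamma>1 t = \<gamma>2 t"
proof -
  let ?J = "J1 \<inter> J2"
  define E where "E = {s \<in> ?J. \<gamma>1 s = \<gamma>2 s}"
  define N where "N = {s \<in> ?J. \<gamma>1 s \<noteq> \<gamma>2 s}"
  have "open E"
  proof (rule open_real_if_neighbourhoods)
    fix s assume "s \<in> E"
    then have "\<exists>e>0. \<forall>r. \<bar>r - s\<bar> < e \<longrightarrow> r \<in> ?J \<and> \<gamma>1 r = \<gamma>2 r"
      by (intro integral_curve_unique_near[OF X 1(1) _ 2(1)]) (auto simp: E_def)
    then show "\<exists>e>0. \<forall>r. \<bar>r - s\<bar> < e \<longrightarrow> r \<in> E"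
      by (simp add: E_def)
  qed
  moreover have "open N"
  proof -
    have "continuous_on ?J (\<lambda>s. (\<gamma>1 s, \<gamma>2 s))" "open ?J"
      using 1(1) 2(1) by (auto simp: integral_curve_def intro!: continuous_on_Pair intro: continuous_on_subset)
    then have "open (?J \<inter> (\<lambda>s. (\<gamma>1 s, \<gamma>2 s)) -` {(a, b) | a b. a \<noteq> b})"
      by (rule continuous_open_preimage) (rule open_diagonal_complement)
    then show ?thesis
      by (simp add: N_def vimage_def Int_def)
  qed
  moreover have "connected ?J"
    using 1(1) 2(1) by (intro is_interval_connected is_interval_Int) (auto simp: integral_curve_def)
  ultimately have "E \<inter> ?J = {} \<or> N \<inter> ?J = {}"
    by (intro connectedD) (auto simp: E_def N_def)
  then show ?thesis
    using assms by (auto simp: E_def N_def)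
qed

lemma flow_eq_integral_curve:
  assumes X: "lipschitz_vf X" and \<gamma>: "integral_curve A X J \<gamma>" "0 \<in> J" "t \<in> J"
  shows "flow A X t (\<gamma> 0) = \<gamma> t"
  unfolding flow_def using assms integral_curve_unique[OF X] by (intro the_equality) blast+

lemma in_flow_domain:
  assumes "integral_curve A X J \<gamma>" "0 \<in> J" "t \<in> J"
  shows "t \<in> flow_domain A X (\<gamma> 0)"
  unfolding flow_domain_def using assms by blast

end

section \<open>Submanifolds and invariance\<close>

context smooth_manifold
begin

definition slice :: "('m, 'e) chart \<Rightarrow> 'e set \<Rightarrow> 'm set \<Rightarrow> bool" where
  "slice c V L \<longleftrightarrow> c \<in> maximal_atlas A \<and> subspace V \<and> cmap c ` (cdom c \<inter> L) = cmap c ` cdom c \<inter> V"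

lemma submanifold_slice:
  assumes "submanifold A d L" "x \<in> L"
  obtains c V where "slice c V L" "x \<in> cdom c" "dim V = d"
  using assms unfolding submanifold_def slice_def by blast

lemma slice_mem_iff:
  assumes "slice c V L" "z \<in> cdom c"
  shows "z \<in> L \<longleftrightarrow> cmap c z \<in> V"
proof
  assume "cmap c z \<in> V"
  then have "cmap c z \<in> cmap c ` (cdom c \<inter> L)"
    using assms by (simp add: slice_def)
  then obtain w where w: "w \<in> cdom c" "w \<in> L" "cmap c z = cmap c w"
    by blast
  have "is_chart c"
    using assms(1) maximal_is_chart by (simp add: slice_def)
  then have "z = w"
    using w(1,3) assms(2) cinv_cmap by metis
  then show "z \<in> L"
    using w(2) by simp
qed (use assms in \<open>auto simp: slice_def\<close>)

text \<open>The inclusion from left to right reads a curve in \<open>L\<close> in the slice chart, where it runs in \<open>V\<close>. For the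
  other one, the straight line through \<open>cmap c x\<close> in the direction \<open>v\<close> stays in \<open>V\<close>.\<close>

lemma tangent_space_slice:
  assumes sl: "slice c V L" and x: "x \<in> cdom c" "x \<in> L"
  shows "tangent_space A L x = tangent_transition A c x ` V"
proof
  have cm: "c \<in> maximal_atlas A" and V: "subspace V"
    using sl by (auto simp: slice_def)
  define c' where "c' = chart_at A x"
  have c': "x \<in> cdom c'" and cc': "compatible c c'"
    using cm by (auto simp: c'_def in_cdom_chart_at compatible_chart_at)
  have ch: "is_chart c" "is_chart c'"
    using compatible_charts[OF cc'] .
  show "tangent_space A L x \<subseteq> tangent_transition A c x ` V"
  proof
    fix v assume "v \<in> tangent_space A L x"
    then obtain e \<gamma> where e: "e > 0" and \<gamma>0: "\<gamma> 0 = x" and \<gamma>: "\<gamma> ` {- e<..<e} \<subseteq> L \<inter> cdom c'"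
      and v: "((cmap c' \<circ> \<gamma>) has_vector_derivative v) (at 0)"
      unfolding tangent_space_def c'_def by blast
    have inv: "cinv c' ((cmap c' \<circ> \<gamma>) s) = \<gamma> s" if "s \<in> {- e<..<e}" for s
      using \<gamma> that by (auto simp: image_subset_iff cinv_cmap[OF ch(2)])
    have "isCont (cmap c' \<circ> \<gamma>) 0"
      using v by (rule has_vector_derivative_continuous)
    moreover have "isCont (cinv c') ((cmap c' \<circ> \<gamma>) 0)"
    proof -
      have "continuous_on (cmap c' ` cdom c') (cinv c')" "open (cmap c' ` cdom c')"
        using ch(2) by (simp_all add: is_chart_def homeomorphism_def)
      then show ?thesis
        using c' \<gamma>0 by (simp add: continuous_on_eq_continuous_at)
    qed
    ultimately have "isCont (\<lambda>s. cinv c' ((cmap c' \<circ> \<gamma>) s)) 0"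
      by (rule isCont_o2)
    moreover have "\<forall>\<^sub>F s in nhds 0. cinv c' ((cmap c' \<circ> \<gamma>) s) = \<gamma> s"
      unfolding eventually_nhds_metric
      by (intro exI[of _ e] conjI allI impI e inv) (auto simp: dist_real_def abs_less_iff)
    ultimately have "isCont \<gamma> 0"
      by (simp only: isCont_cong[of "\<lambda>s. cinv c' ((cmap c' \<circ> \<gamma>) s)" \<gamma>])
    moreover have "open (cdom c)"
      using ch(1) by (simp add: is_chart_def)
    ultimately obtain e1 where e1: "e1 > 0" "\<And>s. \<bar>s - 0\<bar> < e1 \<Longrightarrow> \<gamma> s \<in> cdom c"
      using isCont_real_neighbourhood \<gamma>0 x(1) by metis
    have "((\<lambda>s. cmap c (\<gamma> s)) has_vector_derivative transition_deriv c' c (\<gamma> 0) v) (at 0)"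
      by (rule curve_velocity_transition[OF compatible_sym[OF cc'] \<open>isCont \<gamma> 0\<close>])
        (use v \<gamma>0 x c' in \<open>auto simp: comp_def\<close>)
    then have "transition_deriv c' c (\<gamma> 0) v \<in> V"
    proof (rule velocity_in_subspace[OF V, of _ _ _ "min e e1"])
      fix s :: real assume "\<bar>s - 0\<bar> < min e e1"
      then have "\<gamma> s \<in> L" "\<gamma> s \<in> cdom c"
        using \<gamma> e1(2)[of s] by (auto simp: image_subset_iff abs_less_iff)
      then show "cmap c (\<gamma> s) \<in> V"
        using slice_mem_iff[OF sl] by blast
    qed (use e e1 in simp)
    then show "v \<in> tangent_transition A c x ` V"
      using transition_deriv_inverse[OF compatible_sym[OF cc'] c' x(1), of v] \<gamma>0
      by (auto simp: tangent_transition_eq_transition_deriv c'_def[symmetric] intro!: image_eqI[of _ _ "transition_deriv c' c x v"])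
  qed
  show "tangent_transition A c x ` V \<subseteq> tangent_space A L x"
  proof safe
    fix v assume v: "v \<in> V"
    let ?S = "cmap c ` (cdom c \<inter> cdom c')"
    let ?l = "\<lambda>t. cmap c x + t *\<^sub>R v"
    have "isCont ?l 0"
      by (intro continuous_intros)
    moreover have "?l 0 \<in> ?S"
      using x(1) c' by simp
    ultimately obtain e where e: "e > 0" "\<And>s. \<bar>s - 0\<bar> < e \<Longrightarrow> ?l s \<in> ?S"
      using isCont_real_neighbourhood[OF _ open_overlap[OF cc']] by blast
    have l: "?l s \<in> ?S" if "s \<in> {- e<..<e}" for s
      by (rule e(2)) (use that in auto)
    define \<gamma> where "\<gamma> t = cinv c (?l t)" for t
    have xV: "cmap c x \<in> V"
      using slice_mem_iff[OF sl x(1)] x(2) by simp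
    have "\<gamma> ` {- e<..<e} \<subseteq> L \<inter> cdom c'"
    proof safe
      fix s assume "s \<in> {- e<..<e}"
      then obtain z where z: "?l s = cmap c z" "z \<in> cdom c" "z \<in> cdom c'"
        using l by blast
      have "cmap c z \<in> V"
        unfolding z(1)[symmetric] using xV v V by (intro subspace_add subspace_scale)
      then show "\<gamma> s \<in> L" "\<gamma> s \<in> cdom c'"
        using z slice_mem_iff[OF sl z(2)] cinv_cmap[OF ch(1) z(2)] by (simp_all add: \<gamma>_def)
    qed
    moreover have "\<gamma> 0 = x"
      using cinv_cmap[OF ch(1) x(1)] by (simp add: \<gamma>_def)
    moreover have "smooth_on {- e<..<e} (cmap c' \<circ> \<gamma>)"
      using smooth_on_compose_line[OF open_greaterThanLessThan l smooth_on_overlap[OF cc']]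
      by (simp add: \<gamma>_def comp_def)
    moreover have "((cmap c' \<circ> \<gamma>) has_vector_derivative tangent_transition A c x v) (at 0)"
    proof -
      have lin: "linear (transition_deriv c c' x)"
        by (rule linear_transition_deriv[OF cc' x(1) c'])
      have "(?l has_derivative (\<lambda>s. s *\<^sub>R v)) (at 0)"
        by (auto intro!: derivative_eq_intros)
      then have "((cmap c' \<circ> cinv c) \<circ> ?l has_derivative transition_deriv c c' x \<circ> (\<lambda>s. s *\<^sub>R v)) (at 0)"
        by (rule diff_chain_at) (use has_derivative_transition_deriv[OF cc' x(1) c'] in simp)
      then show ?thesis
        by (simp add: has_vector_derivative_def \<gamma>_def comp_def linear_scale[OF lin]
            tangent_transition_eq_transition_deriv c'_def[symmetric])
    qed
    ultimately show "tangent_transition A c x v \<in> tangent_space A L x"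
      unfolding tangent_space_def c'_def[symmetric] using e(1) by blast
  qed
qed

lemma slice_vf_mem_iff:
  assumes sl: "slice c V L" and x: "x \<in> cdom c" "x \<in> L"
  shows "vf_in_chart A X c (cmap c x) \<in> V \<longleftrightarrow> X x \<in> tangent_space A L x"
proof -
  have cm: "c \<in> maximal_atlas A"
    using sl by (simp add: slice_def)
  have inv: "transition_deriv (chart_at A x) c x (tangent_transition A c x v) = v" for v
    unfolding tangent_transition_eq_transition_deriv
    by (rule transition_deriv_inverse[OF compatible_chart_at[OF cm] x(1) in_cdom_chart_at])
  have "inj (tangent_transition A c x)"
    by (rule inj_on_inverseI) (rule inv)
  then show ?thesis
    unfolding tangent_space_slice[OF assms] tangent_transition_vf_in_chart[OF cm x(1), of X, symmetric]
    by (simp add: inj_image_mem_iff)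
qed

lemma subspace_tangent_space:
  assumes "submanifold A d L" "x \<in> L"
  shows "subspace (tangent_space A L x)" "dim (tangent_space A L x) = d"
proof -
  obtain c V where sl: "slice c V L" and x: "x \<in> cdom c" and d: "dim V = d"
    using submanifold_slice[OF assms] .
  have cm: "c \<in> maximal_atlas A" and V: "subspace V"
    using sl by (auto simp: slice_def)
  have lin: "linear (tangent_transition A c x)"
    by (rule linear_tangent_transition[OF cm x])
  have "inj (tangent_transition A c x)"
    unfolding tangent_transition_eq_transition_deriv
    by (rule injI) (metis transition_deriv_inverse[OF compatible_chart_at[OF cm] x in_cdom_chart_at])
  then have "dim (tangent_transition A c x ` V) = dim V"
    by (intro dim_image_eq[OF lin]) (auto intro: inj_on_subset)
  then show "subspace (tangent_space A L x)" "dim (tangent_space A L x) = d"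
    using linear_subspace_image[OF lin V] d by (simp_all add: tangent_space_slice[OF sl x assms(2)])
qed

text \<open>An integral curve through \<open>x\<close> exists, so invariance is not vacuous. By uniqueness the flow follows
  this curve; it runs in \<open>L\<close>, and its velocity at \<open>x\<close> is \<open>X x\<close>.\<close>

lemma invariant_imp_vf_tangent:
  assumes X: "lipschitz_vf X" and L: "submanifold A d L" and inv: "flow_invariant A X L" and x: "x \<in> L"
  shows "X x \<in> tangent_space A L x"
proof -
  obtain c V where sl: "slice c V L" and xc: "x \<in> cdom c"
    using submanifold_slice[OF L x] by blast
  have cm: "c \<in> maximal_atlas A" and V: "subspace V"
    using sl by (auto simp: slice_def)
  obtain e \<gamma> where e: "e > 0" and \<gamma>: "integral_curve A X {- e<..<e} \<gamma>" and \<gamma>0: "\<gamma> 0 = x"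
    using integral_curve_exists[OF X] by blast
  have in_L: "\<gamma> t \<in> L" if t: "t \<in> {- e<..<e}" for t
  proof -
    have "0 \<in> {- e<..<e}"
      using e by simp
    then have "flow A X t x = \<gamma> t" "t \<in> flow_domain A X x"
      using flow_eq_integral_curve[OF X \<gamma> _ t] in_flow_domain[OF \<gamma> _ t] \<gamma>0 by blast+
    then show ?thesis
      using inv x unfolding flow_invariant_def by metis
  qed
  have "open (cdom c)"
    using maximal_is_chart[OF cm] by (simp add: is_chart_def)
  then obtain e1 where e1: "e1 > 0" "\<And>s. \<bar>s - 0\<bar> < e1 \<Longrightarrow> \<gamma> s \<in> cdom c"
    using isCont_real_neighbourhood[OF integral_curve_isCont[OF \<gamma>], of 0 "cdom c"] \<gamma>0 xc e by auto
  have "((\<lambda>s. cmap c (\<gamma> s)) has_vector_derivative vf_in_chart A X c (cmap c (\<gamma> 0))) (at 0)"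
    by (rule integral_curve_in_chart[OF \<gamma> _ cm]) (use e \<gamma>0 xc in auto)
  then have "vf_in_chart A X c (cmap c (\<gamma> 0)) \<in> V"
  proof (rule velocity_in_subspace[OF V, of _ _ _ "min e e1"])
    fix s :: real assume "\<bar>s - 0\<bar> < min e e1"
    then have "\<gamma> s \<in> L" "\<gamma> s \<in> cdom c"
      using in_L[of s] e1(2)[of s] by (auto simp: abs_less_iff)
    then show "cmap c (\<gamma> s) \<in> V"
      using slice_mem_iff[OF sl] by blast
  qed (use e e1 in simp)
  then show ?thesis
    using slice_vf_mem_iff[OF sl xc x] \<gamma>0 by simp
qed

text \<open>In a slice chart let \<open>Q = id - P\<close> for a linear projection \<open>P\<close> onto \<open>V\<close>, and let \<open>F\<close> be the expression of
  \<open>X\<close>. For an orbit \<open>y\<close>, tangency gives \<open>Q (F (P y)) = 0\<close>, so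
  \<open>|(Q y)'| = |Q (F y - F (P y))| \<le> K B |y - P y| = K B |Q y|\<close>, and \<open>Q y\<close> stays zero.\<close>

lemma vf_tangent_imp_stays_near:
  assumes X: "lipschitz_vf X" and L: "submanifold A d L"
    and tan: "\<And>x. x \<in> L \<Longrightarrow> X x \<in> tangent_space A L x"
    and \<gamma>: "integral_curve A X J \<gamma>" "t \<in> J" "\<gamma> t \<in> L"
  shows "\<exists>e>0. \<forall>s. \<bar>s - t\<bar> < e \<longrightarrow> s \<in> J \<and> \<gamma> s \<in> L"
proof -
  obtain c V where sl: "slice c V L" and xc: "\<gamma> t \<in> cdom c"
    using submanifold_slice[OF L \<gamma>(3)] by blast
  have cm: "c \<in> maximal_atlas A" and V: "subspace V"
    using sl by (auto simp: slice_def)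
  have ch: "is_chart c"
    using cm by (rule maximal_is_chart)
  obtain P where P: "linear P" "\<And>v. P v \<in> V" "\<And>v. v \<in> V \<Longrightarrow> P v = v"
    using subspace_projection[OF V] by blast
  have bP: "bounded_linear P"
    using P(1) by (simp add: linear_conv_bounded_linear)
  let ?F = "vf_in_chart A X c"
  let ?y = "\<lambda>s. cmap c (\<gamma> s)"
  have im: "open (cmap c ` cdom c)" "?y t \<in> cmap c ` cdom c"
    using ch xc by (auto simp: is_chart_def)
  obtain r K where r: "r > 0" and K: "K-lipschitz_on (ball (?y t) r) ?F" and rim: "ball (?y t) r \<subseteq> cmap c ` cdom c"
    using lipschitz_nearE[OF lipschitz_vf_maximal[OF X cm xc] im] .
  have Py: "P (?y t) = ?y t"
    using P(3) slice_mem_iff[OF sl xc] \<gamma>(3) by blast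
  have y_cont: "isCont ?y t"
    using integral_curve_in_chart[OF \<gamma>(1,2) cm xc] by (rule has_vector_derivative_continuous)
  have "open J" "open (cdom c)"
    using \<gamma>(1) ch by (auto simp: integral_curve_def is_chart_def)
  obtain e0 where e0: "e0 > 0" "ball t e0 \<subseteq> J"
    using \<open>open J\<close> \<gamma>(2) openE by blast
  obtain e1 where e1: "e1 > 0" "\<And>s. \<bar>s - t\<bar> < e1 \<Longrightarrow> \<gamma> s \<in> cdom c"
    using isCont_real_neighbourhood[OF integral_curve_isCont[OF \<gamma>(1,2)] \<open>open (cdom c)\<close> xc] by blast
  obtain e2 where e2: "e2 > 0" "\<And>s. \<bar>s - t\<bar> < e2 \<Longrightarrow> ?y s \<in> ball (?y t) r"
    using isCont_real_neighbourhood[OF y_cont open_ball] r by (metis centre_in_ball)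
  obtain e3 where e3: "e3 > 0" "\<And>s. \<bar>s - t\<bar> < e3 \<Longrightarrow> P (?y s) \<in> ball (?y t) r"
    using isCont_real_neighbourhood[OF bounded_linear.isCont[OF bP y_cont] open_ball, of "?y t" r] r Py
    by auto
  define e where "e = min (min e0 e1) (min e2 e3)"
  have near: "s \<in> J" "\<gamma> s \<in> cdom c" "?y s \<in> ball (?y t) r" "P (?y s) \<in> ball (?y t) r"
    if "\<bar>s - t\<bar> < e" for s
    using that e0 e1(2)[of s] e2(2)[of s] e3(2)[of s]
    by (auto simp: e_def dist_real_def abs_minus_commute subset_iff)
  define Q where "Q v = v - P v" for v
  have "bounded_linear Q"
    unfolding Q_def by (intro bounded_linear_sub bounded_linear_ident bP)
  then obtain B where B: "B \<ge> 0" "\<And>v. norm (Q v) \<le> norm v * B"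
    using bounded_linear.nonneg_bounded by blast
  have linQ: "linear Q"
    using \<open>bounded_linear Q\<close> by (simp add: linear_conv_bounded_linear)
  have QV: "Q v = 0 \<longleftrightarrow> v \<in> V" for v
    using P(2)[of v] P(3)[of v] by (auto simp: Q_def)
  have zero: "Q (?y s) = 0" if s: "\<bar>s - t\<bar> < e" for s
  proof (rule ode_zero_unique[where z = "\<lambda>s. Q (?y s)" and z' = "\<lambda>s. Q (?F (?y s))" and a = t and e = e
        and K = "K * B", OF _ _ _ s])
    fix s assume s: "\<bar>s - t\<bar> < e"
    show "((\<lambda>s. Q (?y s)) has_vector_derivative Q (?F (?y s))) (at s)"
      by (rule has_vector_derivative_linear[OF linQ integral_curve_in_chart[OF \<gamma>(1) near(1)[OF s] cm near(2)[OF s]]])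
    obtain z where z: "z \<in> cdom c" "cmap c z = P (?y s)"
      using rim near(4)[OF s] by (metis imageE subsetD)
    have "z \<in> L"
      using slice_mem_iff[OF sl z(1)] P(2) z(2) by simp
    then have "?F (P (?y s)) \<in> V"
      using slice_vf_mem_iff[OF sl z(1)] tan z(2) by metis
    then have "Q (?F (?y s)) = Q (?F (?y s) - ?F (P (?y s)))"
      using QV linear_diff[OF linQ] by simp
    then have "norm (Q (?F (?y s))) \<le> norm (?F (?y s) - ?F (P (?y s))) * B"
      using B(2) by simp
    also have "\<dots> \<le> (K * norm (?y s - P (?y s))) * B"
      using lipschitz_onD[OF K near(3,4)[OF s]] B(1) by (intro mult_right_mono) (simp_all add: dist_norm)
    finally show "norm (Q (?F (?y s))) \<le> K * B * norm (Q (?y s))"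
      by (simp add: Q_def mult_ac)
  qed (simp add: Q_def Py)
  have "s \<in> J \<and> \<gamma> s \<in> L" if s: "\<bar>s - t\<bar> < e" for s
    using near(1,2)[OF s] zero[OF s] QV slice_mem_iff[OF sl] by blast
  moreover have "e > 0"
    using e0(1) e1(1) e2(1) e3(1) by (simp add: e_def)
  ultimately show ?thesis
    by blast
qed

lemma vf_tangent_imp_locally_invariant:
  assumes X: "lipschitz_vf X" and L: "submanifold A d L"
    and tan: "\<And>x. x \<in> L \<Longrightarrow> X x \<in> tangent_space A L x"
  shows "locally_flow_invariant A X L"
  unfolding locally_flow_invariant_def
proof
  fix x assume x: "x \<in> L"
  obtain e0 \<gamma> where e0: "e0 > 0" and \<gamma>: "integral_curve A X {- e0<..<e0} \<gamma>" and \<gamma>0: "\<gamma> 0 = x"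
    using integral_curve_exists[OF X] by blast
  have "\<exists>e>0. \<forall>s. \<bar>s - 0\<bar> < e \<longrightarrow> s \<in> {- e0<..<e0} \<and> \<gamma> s \<in> L"
    by (rule vf_tangent_imp_stays_near[OF X L tan \<gamma>]) (use e0 \<gamma>0 x in auto)
  then obtain e where e: "e > 0" "\<And>s. \<bar>s - 0\<bar> < e \<Longrightarrow> s \<in> {- e0<..<e0} \<and> \<gamma> s \<in> L"
    by blast
  have "flow A X t x \<in> L" if "\<bar>t\<bar> < e" for t
    using e(2)[of t] that flow_eq_integral_curve[OF X \<gamma>, of t] e0 \<gamma>0 by auto
  then show "\<exists>e>0. \<forall>t\<in>flow_domain A X x. \<bar>t\<bar> < e \<longrightarrow> flow A X t x \<in> L"
    using e(1) by blast
qed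

text \<open>Along an orbit, the times spent in \<open>L\<close> form an open set by the local statement, and the times spent
  outside form an open set because \<open>L\<close> is closed.\<close>

lemma vf_tangent_closed_imp_invariant:
  assumes X: "lipschitz_vf X" and L: "submanifold A d L" "closed L"
    and tan: "\<And>x. x \<in> L \<Longrightarrow> X x \<in> tangent_space A L x"
  shows "flow_invariant A X L"
  unfolding flow_invariant_def
proof (intro ballI)
  fix x t assume x: "x \<in> L" and "t \<in> flow_domain A X x"
  then obtain J \<gamma> where \<gamma>: "integral_curve A X J \<gamma>" "0 \<in> J" "t \<in> J" and \<gamma>0: "\<gamma> 0 = x"
    unfolding flow_domain_def by blast
  define E where "E = {s \<in> J. \<gamma> s \<in> L}"
  define N where "N = J \<inter> \<gamma> -` (- L)"
  have "open E"
  proof (rule open_real_if_neighbourhoods)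
    fix s assume "s \<in> E"
    then have "\<exists>e>0. \<forall>r. \<bar>r - s\<bar> < e \<longrightarrow> r \<in> J \<and> \<gamma> r \<in> L"
      by (intro vf_tangent_imp_stays_near[OF X L(1) tan \<gamma>(1)]) (auto simp: E_def)
    then show "\<exists>e>0. \<forall>r. \<bar>r - s\<bar> < e \<longrightarrow> r \<in> E"
      by (simp add: E_def)
  qed
  moreover have "open N"
    unfolding N_def using \<gamma>(1) L(2) by (intro continuous_open_preimage) (auto simp: integral_curve_def)
  moreover have "connected J"
    using \<gamma>(1) by (intro is_interval_connected) (simp add: integral_curve_def)
  ultimately have "E \<inter> J = {} \<or> N \<inter> J = {}"
    by (intro connectedD) (auto simp: E_def N_def)
  then have "\<gamma> t \<in> L"
    using \<gamma>(2,3) \<gamma>0 x by (auto simp: E_def N_def)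
  then show "flow A X t x \<in> L"
    using flow_eq_integral_curve[OF X \<gamma>] \<gamma>0 by simp
qed

end

section \<open>Hamiltonian vector fields\<close>

locale hamiltonian_system = smooth_manifold A
  for A :: "('m::{t2_space, second_countable_topology}, 'e::euclidean_space) chart set" +
  fixes \<eta> \<omega> :: "('m, 'e) dform" and H :: "'m \<Rightarrow> real"
  assumes \<eta>: "differential_form A 1 \<eta>" and \<omega>: "differential_form A 2 \<omega>"
    and nondegenerate: "\<And>x u. (\<And>v. \<omega> x [u, v] = 0) \<Longrightarrow> u = 0"
    and H: "smooth_function A H"
begin

definition \<theta> :: "'m \<Rightarrow> 'e \<Rightarrow> real" where
  "\<theta> x v = lee_deriv A \<eta> 0 (form0 H) x [v]"

definition X\<^sub>H :: "'m \<Rightarrow> 'e" where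
  "X\<^sub>H = hamiltonian_vf A \<eta> \<omega> H"

lemma \<omega>_alternating: "alternating_form 2 (\<omega> x)"
  using \<omega> by (simp add: differential_form_def)

lemma \<omega>_linear: "linear (\<lambda>u. \<omega> x [u, v])" "linear (\<lambda>v. \<omega> x [u, v])"
  using alternating_form_two_linear[OF \<omega>_alternating] by auto

lemma \<eta>_linear: "linear (\<lambda>v. \<eta> x [v])"
  using \<eta> by (intro alternating_form_one_linear) (simp add: differential_form_def)

lemma H_has_derivative:
  assumes "c \<in> A" "x \<in> cdom c"
  shows "((H \<circ> cinv c) has_derivative frechet_derivative (H \<circ> cinv c) (at (cmap c x))) (at (cmap c x))"
  unfolding frechet_derivative_works[symmetric]
  using H assms by (intro smooth_on_differentiable[of "cmap c ` cdom c"]) (auto simp: smooth_function_def)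

lemma \<theta>_linear: "linear (\<theta> x)"
  unfolding \<theta>_def[abs_def] lee_deriv_form0
  using linear_compose_sub[OF has_derivative_linear[OF H_has_derivative[OF chart_at_in_atlas in_cdom_chart_at]]
      linear_compose_scale_right[OF \<eta>_linear[of x], of "H x"]] by simp

text \<open>Nondegeneracy makes \<open>u \<mapsto> \<omega>(u, \<cdot>)\<close> injective, hence bijective in finite dimension, so the description
  that defines the Hamiltonian vector field has exactly one solution.\<close>

lemma \<omega>_X\<^sub>H: "\<omega> x [X\<^sub>H x, v] = \<theta> x v"
proof -
  define T where "T u = (\<Sum>b\<in>Basis. \<omega> x [u, b] *\<^sub>R b)" for u
  have T: "T u \<bullet> b = \<omega> x [u, b]" if "b \<in> Basis" for u b
    using that by (simp add: T_def)
  have "linear T"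
    unfolding T_def by (intro linear_of_components \<omega>_linear)
  moreover have "inj T"
    unfolding linear_injective_0[OF \<open>linear T\<close>]
  proof safe
    fix u assume "T u = 0"
    then have "\<omega> x [u, b] = 0" if "b \<in> Basis" for b
      using T[OF that, of u] by simp
    then have "\<omega> x [u, v] = 0" for v
      by (rule eq_zero_if_basis[OF \<omega>_linear(2)])
    then show "u = 0"
      by (rule nondegenerate)
  qed
  ultimately have "surj T"
    by (rule linear_injective_imp_surjective) simp
  then obtain w where w: "T w = (\<Sum>b\<in>Basis. \<theta> x b *\<^sub>R b)"
    by (metis surjD)
  have "\<omega> x [w, v] - \<theta> x v = 0" for v
  proof (rule eq_zero_if_basis[where f = "\<lambda>v. \<omega> x [w, v] - \<theta> x v"])
    show "linear (\<lambda>v. \<omega> x [w, v] - \<theta> x v)"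
      by (intro linear_compose_sub \<omega>_linear \<theta>_linear)
    show "\<omega> x [w, b] - \<theta> x b = 0" if "b \<in> Basis" for b
      using T[OF that, of w] that by (simp add: w)
  qed
  then have sol: "\<forall>v. \<omega> x [w, v] = \<theta> x v"
    by simp
  have "\<forall>v. \<omega> x [X\<^sub>H x, v] = \<theta> x v"
    unfolding X\<^sub>H_def hamiltonian_vf_def \<theta>_def[symmetric]
  proof (rule theI[of "\<lambda>w. \<forall>v. \<omega> x [w, v] = \<theta> x v", OF sol])
    fix w' assume "\<forall>v. \<omega> x [w', v] = \<theta> x v"
    then have "w' - w = 0"
      using sol by (intro nondegenerate[of x]) (simp add: linear_diff[OF \<omega>_linear(1)])
    then show "w' = w"
      by simp
  qed
  then show ?thesis
    by blast
qed

text \<open>In a chart of the atlas the defining equation of \<open>X\<^sub>H\<close>, tested on a basis, is a linear system whose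
  coefficients and right-hand side are smooth.\<close>

lemma lipschitz_vf_X\<^sub>H: "lipschitz_vf X\<^sub>H"
  unfolding lipschitz_vf_def
proof (intro ballI)
  fix c x0 assume c: "c \<in> A" and x0: "x0 \<in> cdom c"
  have cm: "c \<in> maximal_atlas A"
    using c by (rule atlas_subset_maximal)
  have ch: "is_chart c"
    using cm by (rule maximal_is_chart)
  let ?S = "cmap c ` cdom c"
  have S: "open ?S" "cmap c x0 \<in> ?S"
    using ch x0 by (auto simp: is_chart_def)
  let ?dH = "\<lambda>y v. frechet_derivative (H \<circ> cinv c) (at y) v"
  let ?T = "\<lambda>y. tangent_transition A c (cinv c y)"
  define M where "M y u = (\<Sum>b\<in>Basis. local_form A c \<omega> y [u, b] *\<^sub>R b)" for y u
  define f where "f y v = ?dH y v - (H \<circ> cinv c) y * local_form A c \<eta> y [v]" for y v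
  have lT: "linear (?T y)" if "y \<in> ?S" for y
    using cm cinv_in_cdom[OF ch that] by (rule linear_tangent_transition)
  have l\<omega>: "linear (\<lambda>u. local_form A c \<omega> y [u, v])" "linear (\<lambda>u. local_form A c \<omega> y [v, u])"
    if "y \<in> ?S" for y v
    using linear_compose[OF lT[OF that] \<omega>_linear(1)] linear_compose[OF lT[OF that] \<omega>_linear(2)]
    by (simp_all add: local_form_def comp_def)
  have Mb: "M y u \<bullet> b = local_form A c \<omega> y [u, b]" if "b \<in> Basis" for y u b
    using that by (simp add: M_def)
  show "lipschitz_near (cmap c x0) (vf_in_chart A X\<^sub>H c)"
  proof (rule lipschitz_near_linear_solution[where M = M and c = "\<lambda>y. \<Sum>b\<in>Basis. f y b *\<^sub>R b", OF _ S])
    show "linear (M y)" if "y \<in> ?S" for y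
      unfolding M_def by (intro linear_of_components l\<omega> that)
    have "smooth_on ?S (\<lambda>y. local_form A c \<omega> y [u, v])" for u v
      using \<omega> c by (simp add: differential_form_def)
    then show "lipschitz_near (cmap c x0) (\<lambda>y. M y u)" for u
      unfolding M_def by (intro lipschitz_near_sum lipschitz_near_scaleR lipschitz_near_const
          smooth_on_imp_lipschitz_near[OF _ S])
    have sH: "smooth_on ?S (H \<circ> cinv c)"
      using H c by (simp add: smooth_function_def)
    have s\<eta>: "smooth_on ?S (\<lambda>y. local_form A c \<eta> y [v])" for v
      using \<eta> c by (simp add: differential_form_def)
    have "lipschitz_near (cmap c x0) (\<lambda>y. ?dH y v + (- 1) *\<^sub>R ((H \<circ> cinv c) y *\<^sub>R local_form A c \<eta> y [v]))" for v
      by (intro lipschitz_near_add lipschitz_near_scaleR lipschitz_near_const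
          smooth_on_imp_lipschitz_near[OF _ S] sH s\<eta> smooth_on_derivative)
    then have "lipschitz_near (cmap c x0) (\<lambda>y. f y v)" for v
      by (simp add: f_def)
    then show "lipschitz_near (cmap c x0) (\<lambda>y. \<Sum>b\<in>Basis. f y b *\<^sub>R b)"
      by (intro lipschitz_near_sum lipschitz_near_scaleR lipschitz_near_const)
    show "M y (vf_in_chart A X\<^sub>H c y) = (\<Sum>b\<in>Basis. f y b *\<^sub>R b)" if "y \<in> ?S" for y
    proof -
      define x where "x = cinv c y"
      have x: "x \<in> cdom c" "cmap c x = y"
        using that ch by (auto simp: x_def cinv_cmap)
      have "local_form A c \<omega> y [vf_in_chart A X\<^sub>H c y, v] = f y v" for v
      proof -
        let ?v = "tangent_transition A c x v"
        have "local_form A c \<omega> y [vf_in_chart A X\<^sub>H c y, v] = \<theta> x ?v"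
          using tangent_transition_vf_in_chart[OF cm x(1), of X\<^sub>H] x(2)
          by (simp add: local_form_def x_def[symmetric] \<omega>_X\<^sub>H)
        also have "\<dots> = frechet_derivative (H \<circ> cinv (chart_at A x)) (at (cmap (chart_at A x) x)) ?v - H x * \<eta> x [?v]"
          by (simp add: \<theta>_def lee_deriv_form0)
        also have "frechet_derivative (H \<circ> cinv (chart_at A x)) (at (cmap (chart_at A x) x)) ?v = ?dH y v"
        proof -
          have "((H \<circ> cinv c) has_derivative (\<lambda>v. frechet_derivative (H \<circ> cinv (chart_at A x))
              (at (cmap (chart_at A x) x)) (transition_deriv c (chart_at A x) x v))) (at (cmap c x))"
            by (rule has_derivative_transition_deriv_chain[OF compatible_chart_at[OF cm]
                  H_has_derivative[OF chart_at_in_atlas in_cdom_chart_at] _ x(1) in_cdom_chart_at])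
              (simp add: cinv_cmap ch maximal_is_chart atlas_subset_maximal chart_at_in_atlas)
          then show ?thesis
            using frechet_derivative_at x(2) by (metis tangent_transition_eq_transition_deriv)
        qed
        finally show ?thesis
          by (simp add: f_def local_form_def x_def)
      qed
      then show ?thesis
        by (simp add: M_def)
    qed
    show "inj (M (cmap c x0))"
    proof -
      have lM: "linear (M (cmap c x0))"
        unfolding M_def by (intro linear_of_components l\<omega> S)
      show ?thesis
        unfolding linear_injective_0[OF lM]
      proof safe
        fix u assume u: "M (cmap c x0) u = 0"
        let ?T0 = "tangent_transition A c x0" and ?R = "transition_deriv (chart_at A x0) c x0"
        have inv: "?T0 (?R w) = w" "?R (?T0 w) = w" for w
          unfolding tangent_transition_eq_transition_deriv
          using transition_deriv_inverse[OF compatible_sym[OF compatible_chart_at[OF cm]] in_cdom_chart_at x0]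
            transition_deriv_inverse[OF compatible_chart_at[OF cm] x0 in_cdom_chart_at] by auto
        have "local_form A c \<omega> (cmap c x0) [u, v] = 0" for v
          by (rule eq_zero_if_basis[OF l\<omega>(2)[OF S(2)]]) (use Mb[of _ "cmap c x0" u] u in auto)
        then have "\<omega> x0 [?T0 u, ?T0 v] = 0" for v
          by (simp add: local_form_def cinv_cmap[OF ch x0])
        then have "\<omega> x0 [?T0 u, w] = 0" for w
          using inv(1)[of w] by metis
        then have "?T0 u = 0"
          by (rule nondegenerate)
        then have "u = ?R 0"
          using inv(2) by metis
        then show "u = 0"
          using linear_0[OF linear_transition_deriv[OF compatible_sym[OF compatible_chart_at[OF cm]] in_cdom_chart_at x0]] by simp
      qed
    qed
  qed
qed

end

section \<open>Isotropic, coisotropic and degenerate submanifolds\<close>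

context hamiltonian_system
begin

lemma hamiltonian_distribution_eq: "hamiltonian_distribution A \<eta> H x = {v. \<theta> x v = 0}"
  by (simp add: hamiltonian_distribution_def \<theta>_def)

lemma \<theta>_eq_zero_if_X\<^sub>H_eq_zero: "X\<^sub>H x = 0 \<Longrightarrow> \<theta> x v = 0"
  using \<omega>_X\<^sub>H[of x v] linear_0[OF \<omega>_linear(1)[of x v]] by simp

lemma isotropic_invariant_imp_tangent:
  assumes L: "submanifold A d L" and iso: "isotropic A \<omega> L" and inv: "flow_invariant A X\<^sub>H L"
  shows "tangent_to A (hamiltonian_distribution A \<eta> H) L"
  unfolding tangent_to_def hamiltonian_distribution_eq
proof safe
  fix x v assume x: "x \<in> L" and v: "v \<in> tangent_space A L x"
  have "X\<^sub>H x \<in> tangent_space A L x"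
    by (rule invariant_imp_vf_tangent[OF lipschitz_vf_X\<^sub>H L inv x])
  then have "\<omega> x [X\<^sub>H x, v] = 0"
    using iso x v unfolding isotropic_def isotropic_at_def orthogonal_space_def by blast
  then show "\<theta> x v = 0"
    by (simp add: \<omega>_X\<^sub>H)
qed

lemma coisotropic_tangent_imp_X\<^sub>H_tangent:
  assumes "coisotropic A \<omega> L" "tangent_to A (hamiltonian_distribution A \<eta> H) L" "x \<in> L"
  shows "X\<^sub>H x \<in> tangent_space A L x"
proof -
  have "X\<^sub>H x \<in> orthogonal_space (\<omega> x) (tangent_space A L x)"
    using assms(2,3) by (auto simp: orthogonal_space_def \<omega>_X\<^sub>H tangent_to_def hamiltonian_distribution_eq)
  then show ?thesis
    using assms(1,3) unfolding coisotropic_def by blast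
qed

text \<open>Smoothness of forms is a condition on the charts of the atlas. This transfers the continuity that it
  implies to the slice charts of a submanifold.\<close>

lemma local_form_\<omega>_lipschitz:
  assumes c: "c \<in> maximal_atlas A" "x \<in> cdom c"
  shows "lipschitz_near (cmap c x) (\<lambda>y. local_form A c \<omega> y [a, b])"
proof -
  define c' where "c' = chart_at A x"
  have c': "c' \<in> A" "x \<in> cdom c'" and cm': "c' \<in> maximal_atlas A"
    by (auto simp: c'_def chart_at_in_atlas in_cdom_chart_at intro!: atlas_subset_maximal)
  have cc': "compatible c c'"
    using compatible_atlas c(1) c'(1) .
  have ch: "is_chart c" "is_chart c'"
    using compatible_charts[OF cc'] .
  let ?S = "cmap c ` (cdom c \<inter> cdom c')"
  let ?\<tau> = "\<lambda>y. cmap c' (cinv c y)"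
  let ?J = "\<lambda>y. transition_deriv c c' (cinv c y)"
  have S: "open ?S" "cmap c x \<in> ?S"
    using open_overlap[OF cc'] c(2) c'(2) by auto
  have inv: "cinv c y \<in> cdom c" "cinv c y \<in> cdom c'" "cinv c' (?\<tau> y) = cinv c y" if y: "y \<in> ?S" for y
  proof -
    obtain z where z: "y = cmap c z" "z \<in> cdom c" "z \<in> cdom c'"
      using y by blast
    then show "cinv c y \<in> cdom c" "cinv c y \<in> cdom c'" "cinv c' (?\<tau> y) = cinv c y"
      by (simp_all add: cinv_cmap[OF ch(1)] cinv_cmap[OF ch(2)])
  qed
  define G where "G y u v = local_form A c' \<omega> (?\<tau> y) [u, v]" for y u v
  have lin: "linear (\<lambda>u. G y u v)" "linear (\<lambda>v. G y u v)" if "y \<in> ?S" for y u v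
  proof -
    have "linear (tangent_transition A c' (cinv c y))"
      by (rule linear_tangent_transition[OF cm' inv(2)[OF that]])
    from linear_compose[OF this \<omega>_linear(1)] linear_compose[OF this \<omega>_linear(2)]
    show "linear (\<lambda>u. G y u v)" "linear (\<lambda>v. G y u v)"
      by (simp_all add: G_def local_form_def comp_def inv(3)[OF that])
  qed
  have "lipschitz_near (cmap c' x) (\<lambda>z. local_form A c' \<omega> z [u, v])" for u v
  proof (rule smooth_on_imp_lipschitz_near)
    show "smooth_on (cmap c' ` cdom c') (\<lambda>z. local_form A c' \<omega> z [u, v])"
      using \<omega> c'(1) by (simp add: differential_form_def)
  qed (use ch(2) c'(2) in \<open>auto simp: is_chart_def\<close>)
  then have G: "lipschitz_near (cmap c x) (\<lambda>y. G y u v)" for u v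
    unfolding G_def
    by (intro lipschitz_near_compose[OF lipschitz_near_transition[OF cc' c(2) c'(2)]])
      (simp add: cinv_cmap[OF ch(1) c(2)])
  have J: "lipschitz_near (cmap c x) (\<lambda>y. ?J y v)" for v
    by (rule lipschitz_near_transition_deriv[OF cc' c(2) c'(2)])
  have GJ: "lipschitz_near (cmap c x) (\<lambda>y. G y u (?J y b))" for u
    by (rule lipschitz_near_componentwise[OF lin(2) S G J])
  have "lipschitz_near (cmap c x) (\<lambda>y. (\<lambda>u. G y u (?J y b)) (?J y a))"
    by (rule lipschitz_near_componentwise[OF _ S GJ J]) (rule lin(1))
  then show ?thesis
  proof (rule lipschitz_near_transform[OF _ S])
    fix y assume y: "y \<in> ?S"
    have "tangent_transition A c (cinv c y) v = tangent_transition A c' (cinv c y) (?J y v)" for v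
      unfolding tangent_transition_eq_transition_deriv
      using transition_deriv_compose[OF cc' compatible_chart_at[OF cm'] inv(1,2)[OF y] in_cdom_chart_at] .
    then show "G y (?J y a) (?J y b) = local_form A c \<omega> y [a, b]"
      by (simp add: G_def local_form_def inv(3)[OF y])
  qed
qed

text \<open>At regular points the normalized vector \<open>X\<^sub>H\<close>, read in a slice chart, is a unit vector of \<open>V\<close> in the
  kernel of the form. Along a sequence of regular points these unit vectors have a convergent
  subsequence, and its limit is a unit vector in the kernel by continuity of the form.\<close>

lemma pullback_degenerate_on_regular_closure:
  assumes L: "submanifold A d L"
    and tan: "\<And>x. x \<in> L \<Longrightarrow> X\<^sub>H x \<in> tangent_space A L x"
    and F: "tangent_to A (hamiltonian_distribution A \<eta> H) L"
    and x: "x \<in> regular_closure A \<eta> H L"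
  shows "pullback_degenerate_at A \<omega> L x"
proof -
  have xL: "x \<in> L"
    using x by (simp add: regular_closure_def)
  obtain \<xi> where \<xi>: "\<And>n. \<xi> n \<in> L" "\<And>n. \<exists>v. \<theta> (\<xi> n) v \<noteq> 0" "\<xi> \<longlonglongrightarrow> x"
  proof -
    have "x \<in> closure {x \<in> L. \<exists>v. \<theta> x v \<noteq> 0}"
      using x by (simp add: regular_closure_def hamiltonian_distribution_eq set_eq_iff)
    then show ?thesis
      using that unfolding closure_sequential by blast
  qed
  obtain c V where sl: "slice c V L" and xc: "x \<in> cdom c"
    using submanifold_slice[OF L xL] by blast
  have cm: "c \<in> maximal_atlas A" and V: "subspace V"
    using sl by (auto simp: slice_def)
  have ch: "is_chart c"
    using cm by (rule maximal_is_chart)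
  have "open (cdom c)"
    using ch by (simp add: is_chart_def)
  then have "\<forall>\<^sub>F n in sequentially. \<xi> n \<in> cdom c"
    using \<xi>(3) xc topological_tendstoD by blast
  then obtain N where N: "\<And>n. \<xi> (n + N) \<in> cdom c"
    unfolding eventually_sequentially using le_add2 by blast
  define p where "p n = \<xi> (n + N)" for n
  have p: "p n \<in> L" "p n \<in> cdom c" "\<exists>v. \<theta> (p n) v \<noteq> 0" for n
    using \<xi>(1,2) N by (auto simp: p_def)
  have p_lim: "p \<longlonglongrightarrow> x"
    unfolding p_def using \<xi>(3) by (rule LIMSEQ_ignore_initial_segment)
  have "continuous_on (cdom c) (cmap c)"
    using ch by (simp add: is_chart_def homeomorphism_def)
  then have "isCont (cmap c) x"
    using \<open>open (cdom c)\<close> xc by (simp add: continuous_on_eq_continuous_at)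
  then have y_lim: "(\<lambda>n. cmap c (p n)) \<longlonglongrightarrow> cmap c x"
    using p_lim by (rule isCont_tendsto_compose)
  define w where "w n = vf_in_chart A X\<^sub>H c (cmap c (p n))" for n
  have wV: "w n \<in> V" for n
    using slice_vf_mem_iff[OF sl p(2,1)] tan[OF p(1)] by (simp add: w_def)
  have Tw: "tangent_transition A c (p n) (w n) = X\<^sub>H (p n)" for n
    unfolding w_def by (rule tangent_transition_vf_in_chart[OF cm p(2)])
  have w0: "w n \<noteq> 0" for n
  proof
    assume "w n = 0"
    then have "X\<^sub>H (p n) = 0"
      using Tw[of n] linear_0[OF linear_tangent_transition[OF cm p(2)]] by simp
    then show False
      using \<theta>_eq_zero_if_X\<^sub>H_eq_zero p(3) by blast
  qed
  define u where "u n = w n /\<^sub>R norm (w n)" for n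
  have u: "u n \<in> sphere 0 1 \<inter> V" for n
    using w0 V wV by (simp add: u_def subspace_scale)
  have "compact (sphere 0 1 \<inter> V)"
    by (intro compact_Int_closed closed_subspace V compact_sphere)
  then obtain l r where l: "l \<in> sphere 0 1 \<inter> V" and r: "strict_mono r" and u_lim: "(u \<circ> r) \<longlonglongrightarrow> l"
    unfolding compact_def using u by metis
  have ker: "local_form A c \<omega> (cmap c x) [l, v] = 0" if v: "v \<in> V" for v
  proof -
    let ?B = "\<lambda>y a. local_form A c \<omega> y [a, v]"
    have lin: "linear (\<lambda>a. ?B (cmap c z) a)" if "z \<in> cdom c" for z
      using linear_compose[OF linear_tangent_transition[OF cm that] \<omega>_linear(1)]
      by (simp add: local_form_def comp_def cinv_cmap[OF ch that])
    have rep: "?B (cmap c z) a = (\<Sum>b\<in>Basis. (a \<bullet> b) * ?B (cmap c z) b)" if "z \<in> cdom c" for z a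
      by (subst euclidean_representation[of a, symmetric])
        (simp add: linear_sum[OF lin[OF that]] linear_scale[OF lin[OF that]])
    have "?B (cmap c (p n)) (u n) = 0" for n
    proof -
      have "tangent_transition A c (p n) v \<in> tangent_space A L (p n)"
        using v tangent_space_slice[OF sl p(2,1)] by blast
      then have "\<theta> (p n) (tangent_transition A c (p n) v) = 0"
        using F p(1) unfolding tangent_to_def hamiltonian_distribution_eq by blast
      then have "?B (cmap c (p n)) (w n) = 0"
        by (simp add: local_form_def cinv_cmap[OF ch p(2)] Tw \<omega>_X\<^sub>H)
      then show ?thesis
        using linear_scale[OF lin[OF p(2)]] by (simp add: u_def)
    qed
    then have "(\<lambda>n. \<Sum>b\<in>Basis. ((u \<circ> r) n \<bullet> b) * ?B (cmap c (p (r n))) b) = (\<lambda>n. 0)"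
      by (simp add: rep[OF p(2), symmetric])
    moreover have "(\<lambda>n. \<Sum>b\<in>Basis. ((u \<circ> r) n \<bullet> b) * ?B (cmap c (p (r n))) b) \<longlonglongrightarrow>
        (\<Sum>b\<in>Basis. (l \<bullet> b) * ?B (cmap c x) b)"
    proof (intro tendsto_sum tendsto_mult tendsto_inner u_lim tendsto_const)
      fix b :: 'e
      have "isCont (\<lambda>y. ?B y b) (cmap c x)"
        by (rule lipschitz_near_continuous[OF local_form_\<omega>_lipschitz[OF cm xc]])
      then show "(\<lambda>n. ?B (cmap c (p (r n))) b) \<longlonglongrightarrow> ?B (cmap c x) b"
        by (rule isCont_tendsto_compose) (use LIMSEQ_subseq_LIMSEQ[OF y_lim r] in \<open>simp add: comp_def\<close>)
    qed
    ultimately have "(\<Sum>b\<in>Basis. (l \<bullet> b) * ?B (cmap c x) b) = 0"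
      by (simp add: LIMSEQ_const_iff)
    then show ?thesis
      using rep[OF xc, of l] by simp
  qed
  let ?T = "tangent_transition A c x"
  have TL: "tangent_space A L x = ?T ` V"
    by (rule tangent_space_slice[OF sl xc xL])
  have "?T l \<noteq> 0"
  proof
    assume "?T l = 0"
    then have "l = transition_deriv (chart_at A x) c x 0"
      using transition_deriv_inverse[OF compatible_chart_at[OF cm] xc in_cdom_chart_at]
      by (metis tangent_transition_eq_transition_deriv)
    then have "l = 0"
      using linear_0[OF linear_transition_deriv[OF compatible_sym[OF compatible_chart_at[OF cm]] in_cdom_chart_at xc]] by simp
    then show False
      using l by simp
  qed
  moreover have "\<omega> x [?T l, v] = 0" if "v \<in> ?T ` V" for v
    using that ker by (auto simp: local_form_def cinv_cmap[OF ch xc])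
  ultimately show ?thesis
    unfolding pullback_degenerate_at_def TL using l by blast
qed

lemma degenerate_imp_power_zero:
  assumes "submanifold A d L" "x \<in> L" "pullback_degenerate_at A \<omega> L x" "d = 2 * k"
  shows "pullback_zero_at A (2 * k) (\<lambda>x. wedge_power (\<omega> x) k) L x"
  unfolding pullback_zero_at_def
proof (intro allI impI)
  fix vs assume vs: "length vs = 2 * k \<and> set vs \<subseteq> tangent_space A L x"
  obtain u where u: "u \<in> tangent_space A L x" "u \<noteq> 0"
    and ker: "\<And>v. v \<in> tangent_space A L x \<Longrightarrow> \<omega> x [u, v] = 0"
    using assms(3) unfolding pullback_degenerate_at_def by blast
  have ker': "\<omega> x [v, u] = 0" if "v \<in> tangent_space A L x" for v
    using ker[OF that] alternating_form_two_skew[OF \<omega>_alternating, of x v u] by simp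
  show "wedge_power (\<omega> x) k vs = 0"
  proof (rule alternating_form_eq_zero_if_kernel[OF alternating_form_wedge_power[OF \<omega>_alternating] _ _ u])
    show "wedge_power (\<omega> x) k ws = 0"
      if "length ws = 2 * k" "set ws \<subseteq> tangent_space A L x" "u \<in> set ws" for ws
      by (rule wedge_power_eq_zero_if_kernel[OF that(1,3)]) (use that(2) ker ker' in auto)
  qed (use subspace_tangent_space[OF assms(1,2)] assms(4) vs in auto)
qed

lemma degenerate_surface_imp_isotropic:
  assumes "submanifold A 2 L" "x \<in> L" "pullback_degenerate_at A \<omega> L x"
  shows "isotropic_at A \<omega> L x"
proof -
  obtain u where u: "u \<in> tangent_space A L x" "u \<noteq> 0"
    and ker: "\<And>v. v \<in> tangent_space A L x \<Longrightarrow> \<omega> x [u, v] = 0"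
    using assms(3) unfolding pullback_degenerate_at_def by blast
  have "\<omega> x [v, w] = 0" if vw: "v \<in> tangent_space A L x" "w \<in> tangent_space A L x" for v w
  proof (rule alternating_form_eq_zero_if_kernel[OF \<omega>_alternating _ _ u])
    fix ws assume ws: "length ws = 2" "set ws \<subseteq> tangent_space A L x" "u \<in> set ws"
    obtain a b where "ws = [a, b]"
      using ws(1) by (auto simp: length_Suc_conv numeral_2_eq_2)
    then show "\<omega> x ws = 0"
      using ws ker alternating_form_two_skew[OF \<omega>_alternating, of x a b] by auto
  qed (use subspace_tangent_space[OF assms(1,2)] vw in auto)
  then show ?thesis
    by (auto simp: isotropic_at_def orthogonal_space_def)
qed

end

theorem proposition29:
  fixes A :: "('m::{t2_space, second_countable_topology}, 'e::euclidean_space) chart set"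
    and \<eta> \<omega> :: "('m, 'e) dform" and H :: "'m \<Rightarrow> real"
    and L :: "'m set" and d :: nat and X :: "'m \<Rightarrow> 'e" and F :: "'m \<Rightarrow> 'e set"
  assumes "conformal_symplectic A \<eta> \<omega>"
    and "smooth_function A H"
    and "submanifold A d L"
    and "X = hamiltonian_vf A \<eta> \<omega> H"
    and "F = hamiltonian_distribution A \<eta> H"
  shows "(isotropic A \<omega> L \<and> flow_invariant A X L \<longrightarrow> tangent_to A F L) \<and>
         (coisotropic A \<omega> L \<and> tangent_to A F L \<longrightarrow>
            locally_flow_invariant A X L \<and> (closed L \<longrightarrow> flow_invariant A X L)) \<and>
         (flow_invariant A X L \<and> tangent_to A F L \<longrightarrow>
            (\<forall>x\<in>regular_closure A \<eta> H L.
               pullback_degenerate_at A \<omega> L x \<and>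
               (\<forall>k. d = 2 * k \<longrightarrow> pullback_zero_at A (2 * k) (\<lambda>x. wedge_power (\<omega> x) k) L x) \<and>
               (d = 2 \<longrightarrow> isotropic_at A \<omega> L x)))"
proof -
  interpret hamiltonian_system A \<eta> \<omega> H
  proof unfold_locales
    show "u = 0" if "\<And>v. \<omega> x [u, v] = 0" for x u
      using assms(1) that unfolding conformal_symplectic_def by blast
  qed (use assms(1,2) in \<open>auto simp: conformal_symplectic_def\<close>)
  have X: "X = X\<^sub>H"
    using assms(4) by (simp add: X\<^sub>H_def)
  note L = \<open>submanifold A d L\<close>
  show ?thesis
    unfolding X assms(5)
  proof (intro conjI impI ballI allI)
    assume "isotropic A \<omega> L \<and> flow_invariant A X\<^sub>H L"
    then show "tangent_to A (hamiltonian_distribution A \<eta> H) L"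
      using isotropic_invariant_imp_tangent[OF L] by blast
  next
    assume asm: "coisotropic A \<omega> L \<and> tangent_to A (hamiltonian_distribution A \<eta> H) L"
    then have tan: "X\<^sub>H x \<in> tangent_space A L x" if "x \<in> L" for x
      using coisotropic_tangent_imp_X\<^sub>H_tangent that by blast
    show "locally_flow_invariant A X\<^sub>H L"
      by (rule vf_tangent_imp_locally_invariant[OF lipschitz_vf_X\<^sub>H L tan])
    assume "closed L"
    then show "flow_invariant A X\<^sub>H L"
      by (rule vf_tangent_closed_imp_invariant[OF lipschitz_vf_X\<^sub>H L _ tan])
  next
    fix x assume asm: "flow_invariant A X\<^sub>H L \<and> tangent_to A (hamiltonian_distribution A \<eta> H) L"
      and x: "x \<in> regular_closure A \<eta> H L"
    have xL: "x \<in> L"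
      using x by (simp add: regular_closure_def)
    show deg: "pullback_degenerate_at A \<omega> L x"
      using asm x by (intro pullback_degenerate_on_regular_closure[OF L invariant_imp_vf_tangent[OF lipschitz_vf_X\<^sub>H L]]) auto
    show "pullback_zero_at A (2 * k) (\<lambda>x. wedge_power (\<omega> x) k) L x" if "d = 2 * k" for k
      by (rule degenerate_imp_power_zero[OF L xL deg that])
    show "isotropic_at A \<omega> L x" if "d = 2"
      using degenerate_surface_imp_isotropic[OF _ xL deg] L that by simp
  qed
qed

end
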